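(* Let $$\phi_1(t)=(2|t|+1)(|t|-1)^2\,\mathbb{1}_{0\le |t|\le 1},\qquad \phi_2(t)=t(|t|-1)^2\,\mathbb{1}_{0\le|t|\le 1}$$ be the cubic Hermite splines. Let $\mathcal{C}$ be the class of pairs $(\varphi_1,\varphi_2)$ of functions in $L_2(\mathbb{R})$ such that the family $(\varphi_i(\cdot-k))_{i\in\{1,2\},\,k\in\mathbb{Z}}$ is a Riesz basis and such that the quadratic and cubic B-splines can be written as $$\beta^2=\sum_{k\in\mathbb{Z}} a_k\,\varphi_1(\cdot-k)+b_k\,\varphi_2(\cdot-k),\qquad \beta^3=\sum_{k\in\mathbb{Z}} c_k\,\varphi_1(\cdot-k)+d_k\,\varphi_2(\cdot-k)$$ for some sequences $a,b,c,d$ satisfying $\sum_{k\in\mathbb{Z}} |k|^3(|a_k|+|b_k|+|c_k|+|d_k|)<\infty$. Then $(\phi_1,\phi_2)$ is of minimal support among the pairs in $\mathcal{C}$: it belongs to $\mathcal{C}$ and, for every $(\varphi_1,\varphi_2)\in\mathcal{C}$, $$|\mathrm{Supp}\,\phi_1|+|\mathrm{Supp}\,\phi_2|\ \le\ |\mathrm{Supp}\,\varphi_1|+|\mathrm{Supp}\,\varphi_2| .$$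
   Context: The family $(\varphi_i(\cdot-k))_{i=1,\dots,N,\,k\in\mathbb{Z}}$ is a Riesz basis (of the space it generates) if there are constants $0<A\le B<\infty$ such that $A\sum_{i=1}^{N}\sum_{k} c_i[k]^2\le \big\|\sum_{i=1}^{N}\sum_{k} c_i[k]\varphi_i(\cdot-k)\big\|_{L_2}^2\le B\sum_{i=1}^{N}\sum_{k} c_i[k]^2$ for all $c_1,\dots,c_N\in\ell_2(\mathbb{Z})$. The polynomial B-spline $\beta^{n}$ of degree $n$ (order $n+1$) is the compactly supported function with Fourier transform $\widehat{\beta^{n}}(\omega)=\left(\frac{1-\mathrm{e}^{-\mathrm{j}\omega}}{\mathrm{j}\omega}\right)^{n+1}$, where $\widehat f(\omega)=\int_{\mathbb{R}} f(t)\mathrm{e}^{-\mathrm{j}\omega t}\,\mathrm{d}t$ and $\mathrm{j}$ is the imaginary unit; its support is $[0,n+1]$. Equalities between functions are in $L_2(\mathbb{R})$. $|\mathrm{Supp}\,\varphi|$ denotes the size of the support of $\varphi$, that is, the length of the smallest closed interval containing the (essential) support of $\varphi$, equal to $\infty$ if $\varphi$ is not compactly supported. The support size of a pair is the sum of the two support sizes. *)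

theory Defs
  imports "HOL-Analysis.Analysis"
begin

text \<open>Elements of \<open>L\<^sub>2(\<real>)\<close> are represented by real-valued Borel functions.\<close>

definition L2_fun :: "(real \<Rightarrow> real) \<Rightarrow> bool" where
  "L2_fun f \<longleftrightarrow> f \<in> borel_measurable lborel \<and> integrable lborel (\<lambda>t. (f t)\<^sup>2)"

definition L2norm :: "(real \<Rightarrow> real) \<Rightarrow> real" where
  "L2norm f = sqrt (LINT t|lborel. (f t)\<^sup>2)"

text \<open>Unconditional convergence in \<open>L\<^sub>2(\<real>)\<close>. The limit is determined only almost everywhere.
  The membership conditions ensure that the integrals in \<open>L2norm\<close> exist.\<close>

definition L2_has_sum :: "('i \<Rightarrow> real \<Rightarrow> real) \<Rightarrow> (real \<Rightarrow> real) \<Rightarrow> 'i set \<Rightarrow> bool" where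
  "L2_has_sum f g I \<longleftrightarrow> (\<forall>i\<in>I. L2_fun (f i)) \<and> L2_fun g \<and>
     ((\<lambda>F. L2norm (\<lambda>t. (\<Sum>i\<in>F. f i t) - g t)) \<longlongrightarrow> 0) (finite_subsets_at_top I)"

text \<open>The generators \<open>\<phi>\<^sub>1, \<dots>, \<phi>\<^sub>N\<close> are given as a list, so the indices run from \<open>0\<close>. The norm of a
  series presupposes its convergence in \<open>L\<^sub>2(\<real>)\<close>, which is part of the condition.\<close>

definition riesz_basis_shifts :: "(real \<Rightarrow> real) list \<Rightarrow> bool" where
  "riesz_basis_shifts \<phi>s \<longleftrightarrow>
     (\<exists>A B :: real. 0 < A \<and> A \<le> B \<and>
       (\<forall>c :: nat \<Rightarrow> int \<Rightarrow> real.
          (\<forall>i<length \<phi>s. (\<lambda>k. (c i k)\<^sup>2) summable_on UNIV) \<longrightarrow>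
          (\<exists>f. L2_has_sum (\<lambda>(i, k) t. c i k * (\<phi>s ! i) (t - of_int k)) f
                 ({..<length \<phi>s} \<times> UNIV) \<and>
               A * (\<Sum>i<length \<phi>s. infsum (\<lambda>k. (c i k)\<^sup>2) UNIV) \<le> (L2norm f)\<^sup>2 \<and>
               (L2norm f)\<^sup>2 \<le> B * (\<Sum>i<length \<phi>s. infsum (\<lambda>k. (c i k)\<^sup>2) UNIV))))"

definition ess_supp :: "(real \<Rightarrow> real) \<Rightarrow> real set" where
  "ess_supp f = - \<Union>{U. open U \<and> (AE t in lborel. t \<in> U \<longrightarrow> f t = 0)}"

text \<open>The infimum is attained whenever some compact interval contains the support, and is
  \<open>Inf {} = \<infinity>\<close> otherwise. For \<open>f = 0\<close> almost everywhere it is \<open>0\<close>.\<close>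

definition supp_size :: "(real \<Rightarrow> real) \<Rightarrow> ennreal" where
  "supp_size f = Inf {ennreal (b - a) |a b. a \<le> b \<and> ess_supp f \<subseteq> {a..b}}"

definition fourier :: "(real \<Rightarrow> real) \<Rightarrow> real \<Rightarrow> complex" where
  "fourier f \<omega> = (LINT t|lborel. complex_of_real (f t) * exp (- (\<i> * of_real \<omega> * of_real t)))"

text \<open>The Fourier transform determines the function only almost everywhere, hence the choice of a
  representative. At \<open>\<omega> = 0\<close> the quotient is meant as its limit, so that point, where Isabelle
  division would give \<open>0\<close>, is left out: the transform of an integrable function is continuous.\<close>

definition bspline :: "nat \<Rightarrow> real \<Rightarrow> real" where
  "bspline n = (SOME f. integrable lborel f \<and> compact (ess_supp f) \<and>
     (\<forall>\<omega>. \<omega> \<noteq> 0 \<longrightarrow>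
        fourier f \<omega> = ((1 - exp (- (\<i> * of_real \<omega>))) / (\<i> * of_real \<omega>)) ^ (n + 1)))"

definition hermite1 :: "real \<Rightarrow> real" where
  "hermite1 t = (2 * \<bar>t\<bar> + 1) * (\<bar>t\<bar> - 1)\<^sup>2 * indicator {t. 0 \<le> \<bar>t\<bar> \<and> \<bar>t\<bar> \<le> 1} t"

definition hermite2 :: "real \<Rightarrow> real" where
  "hermite2 t = t * (\<bar>t\<bar> - 1)\<^sup>2 * indicator {t. 0 \<le> \<bar>t\<bar> \<and> \<bar>t\<bar> \<le> 1} t"

definition spline_pairs :: "((real \<Rightarrow> real) \<times> (real \<Rightarrow> real)) set" where
  "spline_pairs = {(\<phi>\<^sub>1, \<phi>\<^sub>2).
     L2_fun \<phi>\<^sub>1 \<and> L2_fun \<phi>\<^sub>2 \<and> riesz_basis_shifts [\<phi>\<^sub>1, \<phi>\<^sub>2] \<and>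
     (\<exists>a b c d :: int \<Rightarrow> real.
        (\<lambda>k. \<bar>real_of_int k\<bar> ^ 3 * (\<bar>a k\<bar> + \<bar>b k\<bar> + \<bar>c k\<bar> + \<bar>d k\<bar>)) summable_on UNIV \<and>
        L2_has_sum (\<lambda>k t. a k * \<phi>\<^sub>1 (t - of_int k) + b k * \<phi>\<^sub>2 (t - of_int k)) (bspline 2) UNIV \<and>
        L2_has_sum (\<lambda>k t. c k * \<phi>\<^sub>1 (t - of_int k) + d k * \<phi>\<^sub>2 (t - of_int k)) (bspline 3) UNIV)}"

end

theory Submission
  imports Defs "HOL-Probability.Levy"
begin

text \<open>
  \<^bold>\<open>The lower bound.\<close> Suppose a pair \<open>(\<phi>\<^sub>1, \<phi>\<^sub>2)\<close> reproduces the cubic B-spline and has total support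
  size less than \<open>4\<close>. Enclose each generator in an interval, of total length less than \<open>4\<close>. The number
  of shifts \<open>\<phi>\<^sub>i(\<cdot> - k)\<close> whose interval contains \<open>x\<close>, averaged over a period in \<open>x\<close>, is exactly this
  total length. Hence at some \<open>x\<close> at most three shifts are active, and no others become active on some
  interval \<open>(u, v)\<close> to the right of \<open>x\<close> (\<open>ex_interval_few_active_shifts\<close>). On \<open>(u, v)\<close> the partial sums of
  an unconditionally convergent expansion eventually stop changing, so every integer shift of
  \<open>\<beta>\<^sup>3\<close> coincides there almost everywhere with a combination of these few functions
  (\<open>L2_has_sum_AE_local\<close>). The four shifts of \<open>\<beta>\<^sup>3\<close> that meet a unit cell are therefore linearly
  dependent on \<open>(u, v)\<close>. But their restrictions are four linearly independent cubic polynomials, a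
  contradiction.

  \<^bold>\<open>Membership.\<close> On the cell \<open>[n, n + 1]\<close> only the shifts by \<open>n\<close> and \<open>n + 1\<close> of the Hermite splines are
  nonzero, and they restrict to the basis of the cubics that is dual to values and slopes at the two
  end points. The squared norm of a Hermite series is thus a sum over the cells of one positive
  definite quadratic form in four coefficients, with explicit bounds, and this gives the Riesz
  inequalities together with the convergence of the series. The quadratic and the cubic B-spline are
  continuously differentiable with cubic pieces, so Hermite interpolation at the integers reproduces
  them by a finite sum.

  \<^bold>\<open>The B-splines.\<close> Both parts need the B-splines pointwise, whereas they are specified through their
  Fourier transforms. The truncated-power formulas have the required transforms, because the
  derivative of the spline of degree \<open>n + 1\<close> is a difference of shifts of the one of degree \<open>n\<close>, and
  an integrable function is determined almost everywhere by its transform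
  (\<open>fourier_inject_AE\<close>).
\<close>

section \<open>Square-integrable functions\<close>

lemma L2_fun_measurable: "L2_fun f \<Longrightarrow> f \<in> borel_measurable borel"
  by (simp add: L2_fun_def)

lemma L2_fun_add:
  assumes f: "L2_fun f" and g: "L2_fun g"
  shows "L2_fun (\<lambda>t. f t + g t)"
  unfolding L2_fun_def
proof
  have [measurable]: "f \<in> borel_measurable borel" "g \<in> borel_measurable borel"
    using f g by (auto simp: L2_fun_def)
  show "(\<lambda>t. f t + g t) \<in> borel_measurable lborel" by simp
  show "integrable lborel (\<lambda>t. (f t + g t)\<^sup>2)"
  proof (rule Bochner_Integration.integrable_bound)
    show "integrable lborel (\<lambda>t. 2 * (f t)\<^sup>2 + 2 * (g t)\<^sup>2)"
      using f g by (auto simp: L2_fun_def)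
    show "AE t in lborel. norm ((f t + g t)\<^sup>2) \<le> norm (2 * (f t)\<^sup>2 + 2 * (g t)\<^sup>2)"
    proof (rule AE_I2)
      fix t
      have "(f t + g t)\<^sup>2 + (f t - g t)\<^sup>2 = 2 * (f t)\<^sup>2 + 2 * (g t)\<^sup>2"
        by (simp add: power2_sum power2_diff)
      then have "(f t + g t)\<^sup>2 \<le> 2 * (f t)\<^sup>2 + 2 * (g t)\<^sup>2"
        using zero_le_power2[of "f t - g t"] by linarith
      then show "norm ((f t + g t)\<^sup>2) \<le> norm (2 * (f t)\<^sup>2 + 2 * (g t)\<^sup>2)" by simp
    qed
  qed simp
qed

lemma L2_fun_cmult: "L2_fun f \<Longrightarrow> L2_fun (\<lambda>t. c * f t)"
  by (auto simp: L2_fun_def power_mult_distrib)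

lemma L2_fun_diff: "L2_fun f \<Longrightarrow> L2_fun g \<Longrightarrow> L2_fun (\<lambda>t. f t - g t)"
  using L2_fun_add[of f "\<lambda>t. (-1) * g t"] L2_fun_cmult[of g "-1"] by simp

lemma L2_fun_sum:
  assumes "\<And>i. i \<in> F \<Longrightarrow> L2_fun (f i)"
  shows "L2_fun (\<lambda>t. \<Sum>i\<in>F. f i t)"
  using assms
proof (induction F rule: infinite_finite_induct)
  case (insert x F)
  then show ?case by (simp add: L2_fun_add)
qed (simp_all add: L2_fun_def)

lemma L2_fun_cong_AE:
  assumes "L2_fun f" "g \<in> borel_measurable lborel" "AE t in lborel. g t = f t"
  shows "L2_fun g"
proof -
  have [measurable]: "f \<in> borel_measurable borel" "g \<in> borel_measurable borel"
    using assms by (auto simp: L2_fun_def)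
  have "integrable lborel (\<lambda>t. (f t)\<^sup>2) \<longleftrightarrow> integrable lborel (\<lambda>t. (g t)\<^sup>2)"
    by (rule integrable_cong_AE) (use assms(3) in auto)
  then show ?thesis using assms by (simp add: L2_fun_def)
qed

lemma nn_integral_eq_L2norm:
  assumes "L2_fun f"
  shows "(\<integral>\<^sup>+t. ennreal ((f t)\<^sup>2) \<partial>lborel) = ennreal ((L2norm f)\<^sup>2)"
  using assms by (auto simp: L2_fun_def L2norm_def nn_integral_eq_integral)

text \<open>An expansion with finitely many nonzero terms may represent its limit merely almost everywhere,
  which matters because a B-spline is given only up to null sets.\<close>

lemma L2_has_sum_finite:
  fixes f :: "'i \<Rightarrow> real \<Rightarrow> real"
  assumes K: "finite K" "K \<subseteq> I" "\<And>i t. i \<in> I - K \<Longrightarrow> f i t = 0"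
    and f: "\<And>i. i \<in> I \<Longrightarrow> L2_fun (f i)"
    and g: "g \<in> borel_measurable lborel" "AE t in lborel. g t = (\<Sum>i\<in>K. f i t)"
  shows "L2_has_sum f g I"
  unfolding L2_has_sum_def
proof (intro conjI ballI f)
  show "L2_fun g"
    using K(2) by (intro L2_fun_cong_AE[OF L2_fun_sum[of K f] g] f) blast
  have "eventually (\<lambda>F. finite F \<and> K \<subseteq> F \<and> F \<subseteq> I) (finite_subsets_at_top I)"
    using K(1,2) unfolding eventually_finite_subsets_at_top by (intro exI[of _ K]) simp
  then have "eventually (\<lambda>F. L2norm (\<lambda>t. (\<Sum>i\<in>F. f i t) - g t) = 0) (finite_subsets_at_top I)"
  proof eventually_elim
    case (elim F)
    have "(\<Sum>i\<in>F. f i t) = (\<Sum>i\<in>K. f i t)" for t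
      using elim K(3) by (intro sum.mono_neutral_right) blast+
    then have "AE t in lborel. ((\<Sum>i\<in>F. f i t) - g t)\<^sup>2 = 0"
      using g(2) by auto
    then have "(LINT t|lborel. ((\<Sum>i\<in>F. f i t) - g t)\<^sup>2) = 0"
      by (rule integral_eq_zero_AE)
    then show ?case by (simp add: L2norm_def)
  qed
  then show "((\<lambda>F. L2norm (\<lambda>t. (\<Sum>i\<in>F. f i t) - g t)) \<longlongrightarrow> 0) (finite_subsets_at_top I)"
    by (rule tendsto_eventually)
qed

section \<open>Injectivity of the Fourier transform\<close>

lemma norm_fourier_kernel [simp]: "norm (exp (- (\<i> * complex_of_real w * complex_of_real t))) = 1"
proof -
  have "exp (- (\<i> * complex_of_real w * complex_of_real t)) = cis (- (w * t))"
    by (simp add: cis_conv_exp mult.assoc)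
  then show ?thesis by simp
qed

lemma integrable_fourier_kernel:
  assumes "integrable lborel f"
  shows "integrable lborel (\<lambda>t. complex_of_real (f t) * exp (- (\<i> * of_real w * of_real t)))"
proof (rule Bochner_Integration.integrable_bound)
  show "integrable lborel f" by fact
  have [measurable]: "f \<in> borel_measurable borel" using assms by simp
  have [measurable]: "(\<lambda>t. exp (- (\<i> * complex_of_real w * complex_of_real t))) \<in> borel_measurable borel"
    by (intro borel_measurable_continuous_onI continuous_intros)
  show "(\<lambda>t. complex_of_real (f t) * exp (- (\<i> * of_real w * of_real t))) \<in> borel_measurable lborel"
    by simp
qed (simp add: norm_mult)

lemma fourier_at_0: "fourier f 0 = complex_of_real (LINT t|lborel. f t)"
  by (simp add: fourier_def)

lemma fourier_diff:
  assumes "integrable lborel f" "integrable lborel g"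
  shows "fourier (\<lambda>t. f t - g t) w = fourier f w - fourier g w"
  unfolding fourier_def
  by (subst Bochner_Integration.integral_diff [symmetric])
     (auto intro!: integrable_fourier_kernel assms simp: left_diff_distrib)

text \<open>The transform of a B-spline is prescribed off the origin; continuity supplies the value there.\<close>

lemma fourier_tendsto_at_0:
  assumes "integrable lborel f"
  shows "(\<lambda>n. fourier f (1 / real (Suc n))) \<longlonglongrightarrow> fourier f 0"
  unfolding fourier_def
proof (rule integral_dominated_convergence[where w="\<lambda>t. \<bar>f t\<bar>"])
  show "AE t in lborel. (\<lambda>n. complex_of_real (f t) * exp (- (\<i> * of_real (1 / real (Suc n)) * of_real t)))
      \<longlonglongrightarrow> complex_of_real (f t) * exp (- (\<i> * of_real 0 * of_real t))"
  proof (rule AE_I2)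
    fix t :: real
    have "(\<lambda>n. complex_of_real (1 / real (Suc n))) \<longlonglongrightarrow> complex_of_real 0"
      by (rule tendsto_of_real[OF LIMSEQ_Suc[OF lim_1_over_n]])
    then show "(\<lambda>n. complex_of_real (f t) * exp (- (\<i> * of_real (1 / real (Suc n)) * of_real t)))
      \<longlonglongrightarrow> complex_of_real (f t) * exp (- (\<i> * of_real 0 * of_real t))"
      by (rule tendsto_mult[OF tendsto_const tendsto_exp[OF tendsto_minus[OF
            tendsto_mult[OF tendsto_mult[OF tendsto_const] tendsto_const]]]])
  qed
next
  show "AE t in lborel. norm (complex_of_real (f t) * exp (- (\<i> * of_real (1 / real (Suc n)) * of_real t)))
      \<le> \<bar>f t\<bar>" for n
    by (simp add: norm_mult del: of_real_divide)
qed (use assms integrable_fourier_kernel[OF assms, THEN borel_measurable_integrable] in auto)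

text \<open>The positive and the negative part of \<open>h\<close> have the same transform, hence the same mass. If the mass
  is positive, both parts normalise to probability densities with the same characteristic function,
  and Levy's uniqueness theorem identifies them.\<close>

lemma fourier_zero_imp_AE_zero:
  assumes h: "integrable lborel h" and zero: "\<And>w. fourier h w = 0"
  shows "AE t in lborel. h t = 0"
proof -
  have [measurable]: "h \<in> borel_measurable borel" using h by simp
  define p n where "p = (\<lambda>t. max 0 (h t))" and "n = (\<lambda>t. max 0 (- h t))"
  have p: "integrable lborel p" and n: "integrable lborel n"
    using h unfolding p_def n_def by auto
  have hpn: "h t = p t - n t" for t by (auto simp: p_def n_def)
  have p0: "p t \<ge> 0" and n0: "n t \<ge> 0" for t by (auto simp: p_def n_def)
  have fpn: "fourier p w = fourier n w" for w
    using zero[of w] fourier_diff[OF p n, of w] by (simp add: hpn[symmetric])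
  define m where "m = (LINT t|lborel. p t)"
  have mn: "m = (LINT t|lborel. n t)"
    using fpn[of 0] by (simp add: fourier_at_0 m_def)
  show ?thesis
  proof (cases "m = 0")
    case True
    have "AE t in lborel. p t = 0"
      using True m_def p p0 by (intro integral_nonneg_eq_0_iff_AE[THEN iffD1]) auto
    moreover have "AE t in lborel. n t = 0"
      using True mn n n0 by (intro integral_nonneg_eq_0_iff_AE[THEN iffD1]) auto
    ultimately show ?thesis by eventually_elim (simp add: hpn)
  next
    case False
    then have m: "m > 0"
      using p0 by (simp add: m_def less_le)
    define D where "D q = density lborel (\<lambda>t. ennreal (q t / m))" for q :: "real \<Rightarrow> real"
    have distr: "real_distribution (D q)"
      and char: "char (D q) w = fourier q (- w) / m"
      if q: "integrable lborel q" "\<And>t. q t \<ge> 0" "m = (LINT t|lborel. q t)" for q w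
    proof -
      have [measurable]: "q \<in> borel_measurable borel" using q by simp
      have "emeasure (D q) (space (D q)) = (\<integral>\<^sup>+ t. ennreal (q t / m) \<partial>lborel)"
        by (simp add: D_def emeasure_density)
      also have "\<dots> = ennreal (LINT t|lborel. q t / m)"
        using q m by (intro nn_integral_eq_integral) auto
      also have "\<dots> = 1" using q m by simp
      finally have "prob_space (D q)" by (rule prob_spaceI)
      then show "real_distribution (D q)"
        by (simp add: real_distribution_def real_distribution_axioms_def D_def)
      have [measurable]: "(\<lambda>t. exp (\<i> * complex_of_real (w * t))) \<in> borel_measurable borel"
        by (intro borel_measurable_continuous_onI continuous_intros)
      have "char (D q) w = (LINT t|lborel. (q t / m) *\<^sub>R iexp (w * t))"
        unfolding char_def D_def using q m by (subst integral_density) auto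
      also have "\<dots> = (LINT t|lborel. (complex_of_real (q t) * exp (- (\<i> * of_real (- w) * of_real t))) / m)"
        by (intro Bochner_Integration.integral_cong refl) (simp add: scaleR_conv_of_real mult.assoc)
      also have "\<dots> = fourier q (- w) / m"
        unfolding fourier_def by (rule integral_divide_zero)
      finally show "char (D q) w = fourier q (- w) / m" .
    qed
    have "D p = D n"
      using p n p0 n0 m_def mn distr char fpn by (intro Levy_uniqueness ext) auto
    then have "AE t in lborel. ennreal (p t / m) = ennreal (n t / m)"
      unfolding D_def
      by (intro sigma_finite_measure.density_unique[OF sigma_finite_lborel]) (auto simp: p_def n_def)
    then show ?thesis
    proof eventually_elim
      case (elim t)
      then show ?case using m p0[of t] n0[of t] by (simp add: hpn)
    qed
  qed
qed

lemma fourier_inject_AE: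
  assumes f: "integrable lborel f" and g: "integrable lborel g"
    and eq: "\<And>w. w \<noteq> 0 \<Longrightarrow> fourier f w = fourier g w"
  shows "AE t in lborel. f t = g t"
proof -
  have "fourier f 0 = fourier g 0"
    using fourier_tendsto_at_0[OF f] fourier_tendsto_at_0[OF g] eq
    by (simp add: LIMSEQ_unique del: of_nat_Suc)
  then have "fourier (\<lambda>t. f t - g t) w = 0" for w
    using eq[of w] by (cases "w = 0") (simp_all add: fourier_diff f g)
  then have "AE t in lborel. f t - g t = 0"
    by (intro fourier_zero_imp_AE_zero Bochner_Integration.integrable_diff f g)
  then show ?thesis by simp
qed

section \<open>The B-splines as truncated powers\<close>

lemma ess_supp_subsetI:
  assumes "\<And>t. t \<notin> {a..b} \<Longrightarrow> f t = 0"
  shows "ess_supp f \<subseteq> {a..b}"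
proof -
  have "open (- {a..b})" by (simp add: open_Compl)
  then show ?thesis using assms unfolding ess_supp_def by auto
qed

lemma compact_ess_suppI:
  assumes "\<And>t. t \<notin> {a..b} \<Longrightarrow> f t = 0"
  shows "compact (ess_supp f)"
proof -
  have "closed (ess_supp f)" unfolding ess_supp_def by (intro closed_Compl open_Union) auto
  then have "compact ({a..b} \<inter> ess_supp f)" by (intro compact_Int_closed) auto
  moreover have "{a..b} \<inter> ess_supp f = ess_supp f"
    using ess_supp_subsetI[of a b f, OF assms] by blast
  ultimately show ?thesis by simp
qed

lemma integrable_continuous_bounded_support:
  fixes f :: "real \<Rightarrow> real"
  assumes "continuous_on UNIV f" and supp: "\<And>t. t \<notin> {a..b} \<Longrightarrow> f t = 0"
  shows "integrable lborel f"
proof -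
  have "integrable lborel (\<lambda>t. indicator {a..b} t *\<^sub>R f t)"
    using assms(1) continuous_on_subset by (intro borel_integrable_compact) auto
  moreover have "(\<lambda>t. indicator {a..b} t *\<^sub>R f t) = f"
    using supp by (intro ext) (auto simp: indicator_def of_bool_def)
  ultimately show ?thesis by simp
qed

lemma fourier_shift: "fourier (\<lambda>t. f (t - c)) w = exp (- (\<i> * of_real w * of_real c)) * fourier f w"
proof -
  have "fourier (\<lambda>t. f (t - c)) w =
      (LINT t|lborel. complex_of_real (f (c + 1 * t - c)) * exp (- (\<i> * of_real w * of_real (c + 1 * t))))"
    unfolding fourier_def by (subst lborel_integral_real_affine[where c=1 and t=c]) auto
  also have "\<dots> = (LINT t|lborel. exp (- (\<i> * of_real w * of_real c)) *
      (complex_of_real (f t) * exp (- (\<i> * of_real w * of_real t))))"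
    by (intro Bochner_Integration.integral_cong refl)
       (simp add: distrib_left exp_add[symmetric])
  finally show ?thesis unfolding fourier_def by simp
qed

text \<open>Integration by parts without boundary terms. The finite exceptional set \<open>S\<close> admits the corners of
  the linear B-spline.\<close>

lemma fourier_deriv:
  assumes cont: "continuous_on UNIV f" and supp: "\<And>t. t \<notin> {a..b} \<Longrightarrow> f t = 0"
    and g: "integrable lborel g" and supp': "\<And>t. t \<notin> {a..b} \<Longrightarrow> g t = 0"
    and S: "finite S" and deriv: "\<And>t. t \<notin> S \<Longrightarrow> (f has_real_derivative g t) (at t)"
  shows "fourier g w = \<i> * of_real w * fourier f w"
proof -
  define e where "e t = exp (- (\<i> * complex_of_real w * complex_of_real t))" for t
  have de: "(e has_vector_derivative (- (\<i> * complex_of_real w)) * e t) (at t)" for t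
  proof -
    have "((\<lambda>z. exp (- (\<i> * of_real w * z))) has_field_derivative
        (- (\<i> * complex_of_real w)) * e t) (at (complex_of_real t))"
      unfolding e_def by (auto intro!: derivative_eq_intros)
    then show ?thesis unfolding e_def by (rule has_vector_derivative_real_field)
  qed
  have ce: "continuous_on A e" for A
    unfolding e_def by (intro continuous_intros)
  have cf: "continuous_on A f" for A
    using cont continuous_on_subset by blast
  have f: "integrable lborel f"
    by (rule integrable_continuous_bounded_support[OF cont supp])
  have ige: "integrable lborel (\<lambda>t. g t * e t)" and ife: "integrable lborel (\<lambda>t. f t * e t)"
    unfolding e_def by (intro integrable_fourier_kernel f g)+
  define F where "F t = complex_of_real (f t) * e t" for t
  define F' where "F' t = g t * e t - \<i> * of_real w * (f t * e t)" for t
  \<comment> \<open>The end points of the enlarged interval lie outside \<open>{a..b}\<close>, so \<open>f\<close> vanishes there.\<close>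
  define a' b' where "a' = min a b - 1" and "b' = max a b + 1"
  have "(F' has_integral F b' - F a') {a'..b'}"
  proof (rule fundamental_theorem_of_calculus_interior_strong[OF S])
    show "continuous_on {a'..b'} F"
      unfolding F_def by (intro continuous_intros ce cf)
    show "(F has_vector_derivative F' t) (at t)" if "t \<in> {a'<..<b'} - S" for t
    proof -
      have "((\<lambda>t. complex_of_real (f t)) has_vector_derivative complex_of_real (g t)) (at t)"
        using deriv that by (intro has_vector_derivative_of_real) (auto simp: has_real_derivative_iff_has_vector_derivative)
      from has_vector_derivative_mult[OF this de[of t]]
      show ?thesis by (simp add: F_def[abs_def] F'_def algebra_simps)
    qed
  qed (auto simp: a'_def b'_def)
  moreover have "f a' = 0" "f b' = 0"
    by (rule supp; simp add: a'_def b'_def min_def max_def)+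
  then have "F a' = 0" "F b' = 0"
    by (simp_all add: F_def)
  moreover have "F' t = 0" if "t \<notin> {a'..b'}" for t
  proof -
    have "t \<notin> {a..b}" using that by (auto simp: a'_def b'_def)
    then show ?thesis by (simp add: F'_def supp supp')
  qed
  ultimately have "(F' has_integral 0) UNIV"
    using has_integral_on_superset[of F' 0 "{a'..b'}" UNIV] by auto
  moreover have iF': "integrable lborel F'"
    unfolding F'_def by (intro Bochner_Integration.integrable_diff integrable_mult_right ige ife)
  ultimately have "integral\<^sup>L lborel F' = 0"
    using has_integral_integral_lborel[OF iF'] has_integral_unique by blast
  moreover have "integral\<^sup>L lborel F' = fourier g w - \<i> * of_real w * fourier f w"
    unfolding F'_def fourier_def using ige ife by (simp add: e_def)
  ultimately show ?thesis by simp
qed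

text \<open>The truncated power \<open>(t\<^sub>+)\<^sup>n\<close>. For \<open>n = 0\<close> this is the constant \<open>1\<close> and not the Heaviside function,
  since \<open>0 ^ 0 = 1\<close>; the piecewise constant case is therefore treated separately by an indicator
  function.\<close>

definition trunc_pow :: "nat \<Rightarrow> real \<Rightarrow> real" where
  "trunc_pow n t = max 0 t ^ n"

lemma continuous_on_trunc_pow [continuous_intros]:
  "continuous_on A f \<Longrightarrow> continuous_on A (\<lambda>t. trunc_pow n (f t))"
  unfolding trunc_pow_def by (intro continuous_intros)

lemma trunc_pow_simps: "t \<le> 0 \<Longrightarrow> n > 0 \<Longrightarrow> trunc_pow n t = 0" "t \<ge> 0 \<Longrightarrow> trunc_pow n t = t ^ n"
  by (auto simp: trunc_pow_def max_def)

lemma has_real_derivative_trunc_pow: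
  assumes "n > 0 \<or> t \<noteq> 0"
  shows "(trunc_pow (Suc n) has_real_derivative (if n = 0 \<and> t < 0 then 0 else real (Suc n) * trunc_pow n t)) (at t)"
proof -
  consider "t < 0" | "t > 0" | "t = 0" "n > 0" using assms by linarith
  then show ?thesis
  proof cases
    case 1
    have "((\<lambda>_. 0) has_real_derivative 0) (at t)" by simp
    then have "(trunc_pow (Suc n) has_real_derivative 0) (at t)"
      by (rule has_field_derivative_transform_within_open[where S="{..<0}"]) (use 1 in \<open>auto simp: trunc_pow_simps\<close>)
    then show ?thesis using 1 by (auto simp: trunc_pow_simps)
  next
    case 2
    have "((\<lambda>t. t ^ Suc n) has_real_derivative real (Suc n) * t ^ n) (at t)"
      by (rule derivative_eq_intros refl | simp)+
    then have "(trunc_pow (Suc n) has_real_derivative real (Suc n) * t ^ n) (at t)"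
      by (rule has_field_derivative_transform_within_open[where S="{0<..}"]) (use 2 in \<open>auto simp: trunc_pow_simps\<close>)
    then show ?thesis using 2 by (auto simp: trunc_pow_simps)
  next
    case 3
    have "((\<lambda>h. trunc_pow n h) \<longlongrightarrow> 0) (at 0)"
    proof -
      have "isCont (trunc_pow n) 0"
        using continuous_on_trunc_pow[OF continuous_on_id, of UNIV n] by (simp add: continuous_on_eq_continuous_at)
      moreover have "trunc_pow n 0 = 0" using 3 by (simp add: trunc_pow_def)
      ultimately show ?thesis unfolding isCont_def by simp
    qed
    moreover have "trunc_pow (Suc n) h / h = trunc_pow n h" if "h \<noteq> 0" for h
      using that 3 by (auto simp: trunc_pow_def max_def)
    then have "eventually (\<lambda>h. trunc_pow n h = trunc_pow (Suc n) h / h) (at 0)"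
      by (auto simp: eventually_at_filter)
    ultimately have "((\<lambda>h. trunc_pow (Suc n) h / h) \<longlongrightarrow> 0) (at 0)"
      by (rule Lim_transform_eventually)
    then show ?thesis using 3 by (simp add: DERIV_def trunc_pow_def zero_power)
  qed
qed

lemma has_real_derivative_trunc_pow_shift:
  assumes "n > 0 \<or> t \<noteq> c"
  shows "((\<lambda>t. trunc_pow (Suc n) (t - c)) has_real_derivative
    (if n = 0 \<and> t < c then 0 else real (Suc n) * trunc_pow n (t - c))) (at t)"
proof -
  have "(trunc_pow (Suc n) has_real_derivative (if n = 0 \<and> t < c then 0 else real (Suc n) * trunc_pow n (t - c))) (at (t - c))"
    using has_real_derivative_trunc_pow[of n "t - c"] assms by simp
  moreover have "((\<lambda>t. t - c) has_real_derivative 1) (at t)"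
    by (auto intro!: derivative_eq_intros)
  ultimately show ?thesis using DERIV_chain2 by fastforce
qed

text \<open>The divided-difference formula for the B-splines: iterated backward differences of a truncated
  power.\<close>

definition bspl1 :: "real \<Rightarrow> real" where
  "bspl1 t = trunc_pow 1 t - 2 * trunc_pow 1 (t - 1) + trunc_pow 1 (t - 2)"

definition bspl2 :: "real \<Rightarrow> real" where
  "bspl2 t = (trunc_pow 2 t - 3 * trunc_pow 2 (t - 1) + 3 * trunc_pow 2 (t - 2) - trunc_pow 2 (t - 3)) / 2"

definition bspl3 :: "real \<Rightarrow> real" where
  "bspl3 t = (trunc_pow 3 t - 4 * trunc_pow 3 (t - 1) + 6 * trunc_pow 3 (t - 2) - 4 * trunc_pow 3 (t - 3) + trunc_pow 3 (t - 4)) / 6"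

lemma continuous_on_bspl:
  "continuous_on A bspl1" "continuous_on A bspl2" "continuous_on A bspl3"
  unfolding bspl1_def[abs_def] bspl2_def[abs_def] bspl3_def[abs_def]
  by (intro continuous_intros; simp)+

lemma bspl_support:
  "t \<notin> {0..2} \<Longrightarrow> bspl1 t = 0" "t \<notin> {0..3} \<Longrightarrow> bspl2 t = 0" "t \<notin> {0..4} \<Longrightarrow> bspl3 t = 0"
  by (auto simp: bspl1_def bspl2_def bspl3_def trunc_pow_def max_def field_simps power2_eq_square
      power3_eq_cube not_le)

lemma integrable_bspl:
  "integrable lborel bspl1" "integrable lborel bspl2" "integrable lborel bspl3"
  by (auto intro!: integrable_continuous_bounded_support continuous_on_bspl bspl_support)

definition bspl0 :: "real \<Rightarrow> real" where
  "bspl0 t = indicator {0..1} t"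

lemma integrable_bspl0: "integrable lborel bspl0"
  unfolding bspl0_def[abs_def] by (rule integrable_real_indicator) auto

lemma fourier_bspl0:
  assumes "w \<noteq> 0"
  shows "fourier bspl0 w = (1 - exp (- (\<i> * of_real w))) / (\<i> * of_real w)"
proof -
  define F where "F t = - exp (- (\<i> * of_real w * complex_of_real t)) / (\<i> * of_real w)" for t
  have "(F has_vector_derivative exp (- (\<i> * of_real w * of_real t))) (at t within {0..1})" for t
  proof -
    have "((\<lambda>z. - exp (- (\<i> * of_real w * z)) / (\<i> * of_real w)) has_field_derivative
        exp (- (\<i> * complex_of_real w * of_real t))) (at (complex_of_real t))"
      using assms by (auto intro!: derivative_eq_intros)
    from has_vector_derivative_real_field[OF this] show ?thesis
      unfolding F_def by (rule has_vector_derivative_at_within)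
  qed
  then have "(LINT t|lborel. indicator {0..1} t *\<^sub>R exp (- (\<i> * of_real w * of_real t))) = F 1 - F 0"
    by (intro integral_FTC_Icc continuous_intros) auto
  moreover have "fourier bspl0 w = (LINT t|lborel. indicator {0..1} t *\<^sub>R exp (- (\<i> * of_real w * of_real t)))"
    unfolding fourier_def bspl0_def by (intro Bochner_Integration.integral_cong refl) (auto simp: indicator_def)
  ultimately show ?thesis using assms by (simp add: F_def field_simps)
qed

text \<open>Raising the degree by one multiplies the transform by \<open>(1 - e\<^sup>-\<^sup>j\<^sup>\<omega>) / (j\<omega>)\<close>: the derivative of \<open>f\<close> is a
  backward difference of \<open>g\<close>.\<close>

lemma fourier_bspline_step:
  assumes cont: "continuous_on UNIV f" and supp: "\<And>t. t \<notin> {0..m + 1} \<Longrightarrow> f t = 0"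
    and g: "integrable lborel g" and supp': "\<And>t. t \<notin> {0..m} \<Longrightarrow> g t = 0"
    and S: "finite S" and m: "0 \<le> m"
    and deriv: "\<And>t. t \<notin> S \<Longrightarrow> (f has_real_derivative g t - g (t - 1)) (at t)"
    and w: "w \<noteq> 0"
  shows "fourier f w = (1 - exp (- (\<i> * of_real w))) / (\<i> * of_real w) * fourier g w"
proof -
  have g': "integrable lborel (\<lambda>t. g (t - 1))"
    using lborel_integrable_real_affine[OF g, of 1 "-1"] by (simp add: add.commute)
  have "\<i> * of_real w * fourier f w = fourier (\<lambda>t. g t - g (t - 1)) w"
  proof (rule fourier_deriv[symmetric, OF cont supp])
    show "g t - g (t - 1) = 0" if "t \<notin> {0..m + 1}" for t
      using supp'[of t] supp'[of "t - 1"] that m by (auto simp: not_le)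
  qed (use S deriv g g' in auto)
  also have "\<dots> = (1 - exp (- (\<i> * of_real w))) * fourier g w"
    using fourier_shift[of g 1 w] by (simp add: fourier_diff g g' left_diff_distrib)
  finally show ?thesis using w by (simp add: field_simps)
qed

lemma fourier_bspl1:
  assumes "w \<noteq> 0"
  shows "fourier bspl1 w = ((1 - exp (- (\<i> * of_real w))) / (\<i> * of_real w)) ^ 2"
proof -
  have "fourier bspl1 w = (1 - exp (- (\<i> * of_real w))) / (\<i> * of_real w) * fourier bspl0 w"
  proof (rule fourier_bspline_step[where m=1 and S="{0, 1, 2}"])
    fix t :: real assume t: "t \<notin> {0, 1, 2}"
    have "((\<lambda>t. trunc_pow 1 (t - c)) has_real_derivative (if t < c then 0 else 1)) (at t)" if "t \<noteq> c" for c
      using has_real_derivative_trunc_pow_shift[of 0 t c] that by (auto simp: trunc_pow_def)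
    from DERIV_add[OF DERIV_diff[OF this[of 0] DERIV_cmult[OF this[of 1], of 2]] this[of 2]]
    show "(bspl1 has_real_derivative bspl0 t - bspl0 (t - 1)) (at t)"
      using t by (auto simp: bspl1_def[abs_def] bspl0_def indicator_def split: if_splits)
  qed (use assms continuous_on_bspl bspl_support integrable_bspl0 in \<open>auto simp: bspl0_def indicator_def\<close>)
  then show ?thesis by (simp add: fourier_bspl0[OF assms] power2_eq_square)
qed

lemma has_real_derivative_bspl:
  "(bspl2 has_real_derivative bspl1 t - bspl1 (t - 1)) (at t)"
  "(bspl3 has_real_derivative bspl2 t - bspl2 (t - 1)) (at t)"
proof -
  have D2: "((\<lambda>t. trunc_pow 2 (t - c)) has_real_derivative 2 * trunc_pow 1 (t - c)) (at t)"
   and D3: "((\<lambda>t. trunc_pow 3 (t - c)) has_real_derivative 3 * trunc_pow 2 (t - c)) (at t)" for c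
    using has_real_derivative_trunc_pow_shift[of 1 t c] has_real_derivative_trunc_pow_shift[of 2 t c]
    by (simp_all add: numeral_2_eq_2 numeral_3_eq_3)
  note D2_0 = D2[of 0, simplified] and D3_0 = D3[of 0, simplified]
  show "(bspl2 has_real_derivative bspl1 t - bspl1 (t - 1)) (at t)"
    unfolding bspl2_def[abs_def] bspl1_def
    by (rule derivative_eq_intros D2_0 D2 refl)+ (simp add: diff_diff_eq, simp add: field_simps)
  show "(bspl3 has_real_derivative bspl2 t - bspl2 (t - 1)) (at t)"
    unfolding bspl3_def[abs_def] bspl2_def
    by (rule derivative_eq_intros D3_0 D3 refl)+ (simp add: diff_diff_eq, simp add: field_simps)
qed

lemma fourier_bspl2:
  assumes "w \<noteq> 0"
  shows "fourier bspl2 w = ((1 - exp (- (\<i> * of_real w))) / (\<i> * of_real w)) ^ 3"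
proof -
  have "fourier bspl2 w = (1 - exp (- (\<i> * of_real w))) / (\<i> * of_real w) * fourier bspl1 w"
    by (rule fourier_bspline_step[where m=2 and S="{}"])
       (use assms continuous_on_bspl bspl_support integrable_bspl has_real_derivative_bspl in auto)
  then show ?thesis by (simp only: fourier_bspl1[OF assms]) (simp add: eval_nat_numeral)
qed

lemma fourier_bspl3:
  assumes "w \<noteq> 0"
  shows "fourier bspl3 w = ((1 - exp (- (\<i> * of_real w))) / (\<i> * of_real w)) ^ 4"
proof -
  have "fourier bspl3 w = (1 - exp (- (\<i> * of_real w))) / (\<i> * of_real w) * fourier bspl2 w"
    by (rule fourier_bspline_step[where m=3 and S="{}"])
       (use assms continuous_on_bspl bspl_support integrable_bspl has_real_derivative_bspl in auto)
  then show ?thesis by (simp only: fourier_bspl2[OF assms]) (simp add: eval_nat_numeral)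
qed

text \<open>The choice behind \<open>bspline\<close> has some admissible value, namely \<open>f\<close>, and by injectivity of the Fourier
  transform any two admissible values agree almost everywhere.\<close>

lemma bspline_AE_eqI:
  assumes f: "integrable lborel f" and supp: "\<And>t. t \<notin> {a..b} \<Longrightarrow> f t = 0"
    and fourier: "\<And>w. w \<noteq> 0 \<Longrightarrow> fourier f w = ((1 - exp (- (\<i> * of_real w))) / (\<i> * of_real w)) ^ (n + 1)"
  shows "integrable lborel (bspline n)" and "AE t in lborel. bspline n t = f t"
proof -
  define P where "P g \<longleftrightarrow> integrable lborel g \<and> compact (ess_supp g) \<and>
     (\<forall>w. w \<noteq> 0 \<longrightarrow> fourier g w = ((1 - exp (- (\<i> * of_real w))) / (\<i> * of_real w)) ^ (n + 1))" for g
  have "P f"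
    using f compact_ess_suppI[of a b f] supp fourier by (auto simp: P_def)
  then have P: "P (bspline n)"
    unfolding bspline_def P_def[symmetric] by (rule someI[of P f])
  then show b: "integrable lborel (bspline n)" by (simp add: P_def)
  show "AE t in lborel. bspline n t = f t"
    using P fourier by (intro fourier_inject_AE b f) (simp add: P_def)
qed

lemma bspline2_AE: "integrable lborel (bspline 2)" "AE t in lborel. bspline 2 t = bspl2 t"
  by (rule bspline_AE_eqI[OF integrable_bspl(2) bspl_support(2)]; simp add: fourier_bspl2)+

lemma bspline3_AE: "integrable lborel (bspline 3)" "AE t in lborel. bspline 3 t = bspl3 t"
  by (rule bspline_AE_eqI[OF integrable_bspl(3) bspl_support(3)]; simp add: fourier_bspl3)+

section \<open>Hermite series and the Riesz property\<close>

text \<open>The cubic on \<open>[0, 1]\<close> with values \<open>u\<close>, \<open>u'\<close> and slopes \<open>v\<close>, \<open>v'\<close> at the end points \<open>0\<close> and \<open>1\<close>.\<close>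

definition hermite_cell :: "real \<Rightarrow> real \<Rightarrow> real \<Rightarrow> real \<Rightarrow> real \<Rightarrow> real" where
  "hermite_cell u v u' v' s =
     u * ((2 * s + 1) * (1 - s)\<^sup>2) + v * (s * (1 - s)\<^sup>2) + u' * (s\<^sup>2 * (3 - 2 * s)) + v' * (s\<^sup>2 * (s - 1))"

text \<open>The quadratic form \<open>\<integral>\<^sub>0\<^sup>1 (hermite_cell u v u' v' s)\<^sup>2 ds\<close>. The reflection \<open>s \<mapsto> 1 - s\<close> exchanges the end
  points and reverses slopes, so the form splits into a block in \<open>(u + u', v - v')\<close> and a block in
  \<open>(u - u', v + v')\<close>.\<close>

definition cell_energy :: "real \<Rightarrow> real \<Rightarrow> real \<Rightarrow> real \<Rightarrow> real" where
  "cell_energy u v u' v' =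
    (105 * (u + u')\<^sup>2 + 35 * ((u + u') * (v - v')) + 7 / 2 * (v - v')\<^sup>2
     + 51 * (u - u')\<^sup>2 + 9 * ((u - u') * (v + v')) + 1 / 2 * (v + v')\<^sup>2) / 420"

lemma nn_integral_hermite_cell:
  "(\<integral>\<^sup>+s. ennreal ((hermite_cell u v u' v' s)\<^sup>2) * indicator {0..1} s \<partial>lborel) =
   ennreal (cell_energy u v u' v')"
proof -
  define p q where "p = - 3 * u - 2 * v + 3 * u' - v'" and "q = 2 * u + v - 2 * u' + v'"
  have cell: "hermite_cell u v u' v' s = u + v * s + p * s ^ 2 + q * s ^ 3" for s
    by (simp add: hermite_cell_def p_def q_def algebra_simps power2_eq_square power3_eq_cube)
  \<comment> \<open>The antiderivative of the squared cubic \<open>u + v s + p s\<^sup>2 + q s\<^sup>3\<close>.\<close>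
  define F where "F s = u\<^sup>2 * s + u * v * s ^ 2 + (v\<^sup>2 + 2 * u * p) * s ^ 3 / 3 + (2 * u * q + 2 * v * p) * s ^ 4 / 4
      + (p\<^sup>2 + 2 * v * q) * s ^ 5 / 5 + p * q * s ^ 6 / 3 + q\<^sup>2 * s ^ 7 / 7" for s
  have "(F has_real_derivative (hermite_cell u v u' v' s)\<^sup>2) (at s)" for s
    unfolding F_def cell
    by (auto intro!: derivative_eq_intros simp: field_simps power2_eq_square eval_nat_numeral)
  then have "(\<integral>\<^sup>+s. ennreal ((hermite_cell u v u' v' s)\<^sup>2) * indicator {0..1} s \<partial>lborel) = ennreal (F 1 - F 0)"
    by (intro nn_integral_FTC_Icc) (auto simp: hermite_cell_def)
  also have "F 1 - F 0 = cell_energy u v u' v'"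
    by (simp add: F_def p_def q_def cell_energy_def field_simps power2_eq_square)
  finally show ?thesis .
qed

text \<open>In each of the two blocks the mixed term is absorbed by completing a square; what remains of the
  squares determines the constants.\<close>

lemma cell_energy_bounds:
  "(u\<^sup>2 + v\<^sup>2 + (u'\<^sup>2 + v'\<^sup>2)) / 4200 \<le> cell_energy u v u' v'"
  "cell_energy u v u' v' \<le> u\<^sup>2 + v\<^sup>2 + (u'\<^sup>2 + v'\<^sup>2)"
proof -
  define P M S D where "P = u + u'" and "M = u - u'" and "S = v + v'" and "D = v - v'"
  have nrm: "u\<^sup>2 + v\<^sup>2 + (u'\<^sup>2 + v'\<^sup>2) = (P\<^sup>2 + M\<^sup>2 + S\<^sup>2 + D\<^sup>2) / 2"
    by (simp add: P_def M_def S_def D_def power2_eq_square field_simps)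
  have "cell_energy u v u' v' =
      (105 * P\<^sup>2 + 35 * (P * D) + 7 / 2 * D\<^sup>2 + 51 * M\<^sup>2 + 9 * (M * S) + 1 / 2 * S\<^sup>2) / 420"
    by (simp only: cell_energy_def P_def M_def S_def D_def)
  then have E: "420 * cell_energy u v u' v' =
      105 * P\<^sup>2 + 35 * (P * D) + 7 / 2 * D\<^sup>2 + 51 * M\<^sup>2 + 9 * (M * S) + 1 / 2 * S\<^sup>2"
    by simp
  \<comment> \<open>Opaque names for the squares turn the remaining estimates into linear ones.\<close>
  define p m s d where "p = P\<^sup>2" and "m = M\<^sup>2" and "s = S\<^sup>2" and "d = D\<^sup>2"
  note defs = p_def [symmetric] m_def [symmetric] s_def [symmetric] d_def [symmetric]
  have pos: "p \<ge> 0" "m \<ge> 0" "s \<ge> 0" "d \<ge> 0" by (simp_all add: p_def m_def s_def d_def)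
  \<comment> \<open>The weights satisfy \<open>2 * 10 * (7 / 4) = 35\<close> and \<open>2 * 7 * (9 / 14) = 9\<close>, and their squares
    stay below the coefficients of \<open>P\<^sup>2\<close>, \<open>D\<^sup>2\<close>, \<open>M\<^sup>2\<close> and \<open>S\<^sup>2\<close>.\<close>
  have "0 \<le> (10 * P + 7 / 4 * D)\<^sup>2" "0 \<le> (7 * M + 9 / 14 * S)\<^sup>2" by simp_all
  then have "35 * (P * D) \<ge> - 100 * p - 49 / 16 * d" "9 * (M * S) \<ge> - 49 * m - 81 / 196 * s"
    by (simp_all add: power2_sum power_mult_distrib power_divide mult.commute defs)
  with E nrm pos show "(u\<^sup>2 + v\<^sup>2 + (u'\<^sup>2 + v'\<^sup>2)) / 4200 \<le> cell_energy u v u' v'"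
    unfolding defs by argo
  have "0 \<le> (P - D)\<^sup>2" "0 \<le> (M - S)\<^sup>2" by simp_all
  then have "2 * (P * D) \<le> p + d" "2 * (M * S) \<le> m + s"
    by (simp_all add: power2_diff defs)
  with E nrm pos show "cell_energy u v u' v' \<le> u\<^sup>2 + v\<^sup>2 + (u'\<^sup>2 + v'\<^sup>2)"
    unfolding defs by argo
qed

text \<open>The sum of all shifts weighted by \<open>c\<close>, evaluated pointwise: at \<open>t\<close> only the shifts by \<open>\<lfloor>t\<rfloor>\<close> and
  \<open>\<lfloor>t\<rfloor> + 1\<close> contribute, so no convergence is involved.\<close>

definition hermite_series :: "(nat \<Rightarrow> int \<Rightarrow> real) \<Rightarrow> real \<Rightarrow> real" where
  "hermite_series c t =
     hermite_cell (c 0 \<lfloor>t\<rfloor>) (c 1 \<lfloor>t\<rfloor>) (c 0 (\<lfloor>t\<rfloor> + 1)) (c 1 (\<lfloor>t\<rfloor> + 1)) (t - of_int \<lfloor>t\<rfloor>)"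

lemma hermite_series_measurable [measurable]: "hermite_series c \<in> borel_measurable borel"
proof -
  have "(\<lambda>t. hermite_cell (c 0 n) (c 1 n) (c 0 (n + 1)) (c 1 (n + 1)) (t - of_int n))
      \<in> borel_measurable borel" for n
    unfolding hermite_cell_def by measurable
  then show ?thesis
    unfolding hermite_series_def by (rule measurable_compose_countable) measurable
qed

text \<open>The real line is cut into the cells \<open>[n, n + 1)\<close>, each translated to the unit interval.\<close>

lemma nn_integral_hermite_series:
  "(\<integral>\<^sup>+t. ennreal ((hermite_series c t)\<^sup>2) \<partial>lborel) =
   (\<integral>\<^sup>+n. ennreal (cell_energy (c 0 n) (c 1 n) (c 0 (n + 1)) (c 1 (n + 1))) \<partial>count_space UNIV)"
proof -
  define f where "f n t = ennreal ((hermite_cell (c 0 n) (c 1 n) (c 0 (n + 1)) (c 1 (n + 1)) t)\<^sup>2)" for n t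
  have [measurable]: "f n \<in> borel_measurable borel" for n
    unfolding f_def hermite_cell_def by measurable
  have "(\<integral>\<^sup>+t. ennreal ((hermite_series c t)\<^sup>2) \<partial>lborel) =
      (\<integral>\<^sup>+t. (\<integral>\<^sup>+n. f n (t - of_int n) * indicator {\<lfloor>t\<rfloor>} n \<partial>count_space UNIV) \<partial>lborel)"
    by (simp add: f_def hermite_series_def)
  also have "\<dots> = (\<integral>\<^sup>+t. (\<integral>\<^sup>+n. f n (t - of_int n) * indicator {0..<1} (t - of_int n) \<partial>count_space UNIV) \<partial>lborel)"
  proof -
    have "indicator {\<lfloor>t\<rfloor>} n = (indicator {0..<1} (t - of_int n) :: ennreal)" for t :: real and n :: int
      using floor_eq_iff[of t n] by (auto simp: indicator_def) linarith
    then show ?thesis by (simp only:)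
  qed
  also have "\<dots> = (\<integral>\<^sup>+n. (\<integral>\<^sup>+t. f n (t - of_int n) * indicator {0..<1} (t - of_int n) \<partial>lborel) \<partial>count_space UNIV)"
    by (rule nn_integral_count_space_nn_integral) auto
  also have "\<dots> = (\<integral>\<^sup>+n. (\<integral>\<^sup>+t. f n t * indicator {0..1} t \<partial>lborel) \<partial>count_space UNIV)"
  proof (rule nn_integral_cong)
    fix n :: int
    have "(\<integral>\<^sup>+t. f n (t - of_int n) * indicator {0..<1} (t - of_int n) \<partial>lborel) = (\<integral>\<^sup>+t. f n t * indicator {0..<1} t \<partial>lborel)"
      by (subst nn_integral_real_affine[where c=1 and t="of_int n"]) auto
    also have "\<dots> = (\<integral>\<^sup>+t. f n t * indicator {0..1} t \<partial>lborel)"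
      using AE_lborel_singleton[of "1::real"]
      by (intro nn_integral_cong_AE) (auto elim!: eventually_mono simp: indicator_def)
    finally show "(\<integral>\<^sup>+t. f n (t - of_int n) * indicator {0..<1} (t - of_int n) \<partial>lborel) =
       (\<integral>\<^sup>+t. f n t * indicator {0..1} t \<partial>lborel)" .
  qed
  finally show ?thesis by (simp add: f_def nn_integral_hermite_cell)
qed

definition coeff_l2 :: "(nat \<Rightarrow> int \<Rightarrow> real) \<Rightarrow> bool" where
  "coeff_l2 c \<longleftrightarrow> (\<forall>i<2. (\<lambda>k. (c i k)\<^sup>2) summable_on UNIV)"

definition coeff_energy :: "(nat \<Rightarrow> int \<Rightarrow> real) \<Rightarrow> real" where
  "coeff_energy c = (\<Sum>i<2. infsum (\<lambda>k. (c i k)\<^sup>2) UNIV)"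

lemma lessThan_2: "{..<2::nat} = {0, 1}" by auto

lemma coeff_energy_nonneg: "coeff_energy c \<ge> 0"
  unfolding coeff_energy_def by (intro sum_nonneg infsum_nonneg) auto

lemma nn_integral_count_space_infsum:
  assumes "f summable_on UNIV" "\<And>x. f x \<ge> (0::real)"
  shows "(\<integral>\<^sup>+x. ennreal (f x) \<partial>count_space UNIV) = ennreal (infsum f UNIV)"
proof -
  have "Infinite_Sum.abs_summable_on f UNIV"
    using assms(1) by (rule summable_on_iff_abs_summable_on_real[THEN iffD1])
  then have "Infinite_Set_Sum.abs_summable_on f UNIV"
    by (rule abs_summable_equivalent[THEN iffD1])
  then show ?thesis
    using assms(2) by (simp only: nn_integral_conv_infsetsum infsetsum_infsum)
qed

lemma nn_integral_coeff_energy: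
  assumes "coeff_l2 c"
  shows "(\<integral>\<^sup>+n. ennreal ((c 0 n)\<^sup>2 + (c 1 n)\<^sup>2) \<partial>count_space UNIV) = ennreal (coeff_energy c)"
proof -
  have "(\<integral>\<^sup>+n. ennreal ((c 0 n)\<^sup>2 + (c 1 n)\<^sup>2) \<partial>count_space UNIV) =
     (\<integral>\<^sup>+n. ennreal ((c 0 n)\<^sup>2) \<partial>count_space UNIV) + (\<integral>\<^sup>+n. ennreal ((c 1 n)\<^sup>2) \<partial>count_space UNIV)"
    by (subst nn_integral_add[symmetric]) auto
  also have "\<dots> = ennreal (coeff_energy c)"
  proof -
    have "(\<integral>\<^sup>+n. ennreal ((c i n)\<^sup>2) \<partial>count_space UNIV) = ennreal (infsum (\<lambda>n. (c i n)\<^sup>2) UNIV)" if "i < 2" for i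
      using assms that by (intro nn_integral_count_space_infsum) (auto simp: coeff_l2_def)
    then show ?thesis
      unfolding coeff_energy_def lessThan_2 by (simp add: ennreal_plus infsum_nonneg)
  qed
  finally show ?thesis .
qed

text \<open>Every coefficient occurs in exactly two neighbouring cells, so each bound for one cell is doubled.\<close>

lemma hermite_series_bounds:
  assumes c: "coeff_l2 c"
  shows "L2_fun (hermite_series c)"
    and "1 / 2100 * coeff_energy c \<le> (L2norm (hermite_series c))\<^sup>2"
    and "(L2norm (hermite_series c))\<^sup>2 \<le> 2 * coeff_energy c"
proof -
  define e where "e n = (c 0 n)\<^sup>2 + (c 1 n)\<^sup>2" for n
  have e0: "e n \<ge> 0" for n by (simp add: e_def)
  have e: "(\<integral>\<^sup>+n. ennreal (e n) \<partial>count_space UNIV) = ennreal (coeff_energy c)"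
    unfolding e_def by (rule nn_integral_coeff_energy[OF c])
  have "(\<integral>\<^sup>+n. ennreal (e (n + 1)) \<partial>count_space UNIV) = (\<integral>\<^sup>+n. ennreal (e n) \<partial>count_space UNIV)"
    by (rule nn_integral_bij_count_space) (rule bij_betw_byWitness[where f'="\<lambda>n. n - 1"], auto)
  moreover have "(\<integral>\<^sup>+n. ennreal (e n + e (n + 1)) \<partial>count_space UNIV) =
      (\<integral>\<^sup>+n. ennreal (e n) \<partial>count_space UNIV) + (\<integral>\<^sup>+n. ennreal (e (n + 1)) \<partial>count_space UNIV)"
    by (subst nn_integral_add[symmetric]) (auto intro!: nn_integral_cong simp: e0)
  ultimately have "(\<integral>\<^sup>+n. ennreal (e n + e (n + 1)) \<partial>count_space UNIV) =
      ennreal (coeff_energy c) + ennreal (coeff_energy c)"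
    by (simp only: e)
  also have "\<dots> = ennreal (2 * coeff_energy c)"
    unfolding mult_2 by (rule ennreal_plus[symmetric]) (rule coeff_energy_nonneg)+
  finally have ee: "(\<integral>\<^sup>+n. ennreal (e n + e (n + 1)) \<partial>count_space UNIV) = ennreal (2 * coeff_energy c)" .
  let ?I = "\<integral>\<^sup>+t. ennreal ((hermite_series c t)\<^sup>2) \<partial>lborel"
  have up: "?I \<le> ennreal (2 * coeff_energy c)"
    unfolding nn_integral_hermite_series ee[symmetric] e_def
    by (intro nn_integral_mono ennreal_leI cell_energy_bounds)
  have "ennreal (1 / 2100 * coeff_energy c) = ennreal (1 / 4200) * ennreal (2 * coeff_energy c)"
    using coeff_energy_nonneg[of c] by (simp add: ennreal_mult[symmetric])
  also have "\<dots> = (\<integral>\<^sup>+n. ennreal (1 / 4200) * ennreal (e n + e (n + 1)) \<partial>count_space UNIV)"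
    unfolding ee[symmetric] by (rule nn_integral_cmult[symmetric]) simp
  also have "\<dots> \<le> ?I"
    unfolding nn_integral_hermite_series
  proof (rule nn_integral_mono)
    fix n :: int
    have "ennreal (1 / 4200) * ennreal (e n + e (n + 1)) = ennreal (1 / 4200 * (e n + e (n + 1)))"
      by (rule ennreal_mult[symmetric]) (simp_all add: e0)
    also have "\<dots> \<le> ennreal (cell_energy (c 0 n) (c 1 n) (c 0 (n + 1)) (c 1 (n + 1)))"
      using cell_energy_bounds(1)[of "c 0 n" "c 1 n" "c 0 (n + 1)" "c 1 (n + 1)"]
      by (intro ennreal_leI) (simp add: e_def)
    finally show "ennreal (1 / 4200) * ennreal (e n + e (n + 1)) \<le>
        ennreal (cell_energy (c 0 n) (c 1 n) (c 0 (n + 1)) (c 1 (n + 1)))" .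
  qed
  finally have low: "ennreal (1 / 2100 * coeff_energy c) \<le> ?I" .
  show L2: "L2_fun (hermite_series c)"
    unfolding L2_fun_def
  proof (intro conjI integrableI_nonneg)
    show "?I < \<infinity>"
      using le_less_trans[OF up ennreal_less_top] by simp
  qed auto
  show "1 / 2100 * coeff_energy c \<le> (L2norm (hermite_series c))\<^sup>2"
    using low unfolding nn_integral_eq_L2norm[OF L2] by (rule ennreal_le_iff[THEN iffD1, rotated]) simp
  show "(L2norm (hermite_series c))\<^sup>2 \<le> 2 * coeff_energy c"
    using up unfolding nn_integral_eq_L2norm[OF L2]
    by (rule ennreal_le_iff[THEN iffD1, rotated]) (simp add: coeff_energy_nonneg)
qed

lemma hermite_eq_0: "1 \<le> \<bar>s\<bar> \<Longrightarrow> hermite1 s = 0" "1 \<le> \<bar>s\<bar> \<Longrightarrow> hermite2 s = 0"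
  by (cases "\<bar>s\<bar> = 1"; simp add: hermite1_def hermite2_def)+

lemma hermite_eq_cell:
  assumes "0 \<le> s" "s < 1"
  shows "hermite1 s = (2 * s + 1) * (1 - s)\<^sup>2" "hermite2 s = s * (1 - s)\<^sup>2"
    and "hermite1 (s - 1) = s\<^sup>2 * (3 - 2 * s)" "hermite2 (s - 1) = s\<^sup>2 * (s - 1)"
  using assms by (simp_all add: hermite1_def hermite2_def power2_eq_square algebra_simps)

definition coeff_restrict :: "(nat \<times> int) set \<Rightarrow> (nat \<Rightarrow> int \<Rightarrow> real) \<Rightarrow> nat \<Rightarrow> int \<Rightarrow> real" where
  "coeff_restrict F c i k = (if (i, k) \<in> F then c i k else 0)"

abbreviation hermite_term :: "(nat \<Rightarrow> int \<Rightarrow> real) \<Rightarrow> nat \<times> int \<Rightarrow> real \<Rightarrow> real" where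
  "hermite_term c \<equiv> (\<lambda>(i, k) t. c i k * ([hermite1, hermite2] ! i) (t - of_int k))"

text \<open>Partial sums are themselves Hermite series, so their norms and those of the remainders are
  controlled by the same two-sided estimate.\<close>

lemma hermite_partial_sum:
  assumes F: "finite F" "F \<subseteq> {..<2} \<times> UNIV"
  shows "(\<Sum>x\<in>F. hermite_term c x t) = hermite_series (coeff_restrict F c) t"
proof -
  define n where "n = \<lfloor>t\<rfloor>"
  define T where "T = {(0::nat, n), (0, n + 1), (1, n), (1, n + 1)}"
  have s: "0 \<le> t - of_int n" "t - of_int n < 1"
    unfolding n_def using floor_correct[of t] by linarith+
  have "hermite_term c x t = 0" if "x \<in> F - F \<inter> T" for x
  proof -
    obtain i k where x: "x = (i, k)" by (cases x)
    with that F have i: "i = 0 \<or> i = 1" and k: "k \<noteq> n" "k \<noteq> n + 1"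
      by (auto simp: T_def)
    from k have "k \<le> n - 1 \<or> k \<ge> n + 2" by linarith
    then have "real_of_int k \<le> of_int n - 1 \<or> real_of_int k \<ge> of_int n + 2" by linarith
    then have "1 \<le> \<bar>t - of_int k\<bar>" using s by linarith
    then show ?thesis using i by (auto simp: x hermite_eq_0)
  qed
  then have "(\<Sum>x\<in>F. hermite_term c x t) = (\<Sum>x\<in>T \<inter> F. hermite_term c x t)"
    using F by (intro sum.mono_neutral_right) (auto simp: Int_commute)
  also have "\<dots> = (\<Sum>x\<in>T. if x \<in> F then hermite_term c x t else 0)"
    by (rule sum.inter_restrict) (simp add: T_def)
  also have "\<dots> = hermite_series (coeff_restrict F c) t"
    using hermite_eq_cell[OF s]
    by (simp add: T_def hermite_series_def hermite_cell_def coeff_restrict_def n_def [symmetric]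
        diff_diff_eq[symmetric])
  finally show ?thesis .
qed

lemma hermite_series_diff:
  "hermite_series c t - hermite_series d t = hermite_series (\<lambda>i k. c i k - d i k) t"
  by (simp add: hermite_series_def hermite_cell_def left_diff_distrib)

lemma coeff_energy_has_sum:
  assumes "coeff_l2 c"
  shows "((\<lambda>(i, k). (c i k)\<^sup>2) has_sum coeff_energy c) ({..<2} \<times> UNIV)"
proof -
  have one: "((\<lambda>(i, k). (c i k)\<^sup>2) has_sum infsum (\<lambda>k. (c j k)\<^sup>2) UNIV) (Pair j ` UNIV)" if "j < 2" for j
  proof (subst has_sum_reindex)
    show "(((\<lambda>(i, k). (c i k)\<^sup>2) \<circ> Pair j) has_sum infsum (\<lambda>k. (c j k)\<^sup>2) UNIV) UNIV"
      using assms that by (simp add: o_def coeff_l2_def)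
  qed (simp add: inj_on_def)
  have "((\<lambda>(i, k). (c i k)\<^sup>2) has_sum (infsum (\<lambda>k. (c 0 k)\<^sup>2) UNIV + infsum (\<lambda>k. (c 1 k)\<^sup>2) UNIV))
     (Pair 0 ` UNIV \<union> Pair 1 ` UNIV)"
    by (rule has_sum_Un_disjoint[OF one one]) auto
  moreover have "Pair 0 ` UNIV \<union> Pair 1 ` UNIV = {..<2::nat} \<times> (UNIV :: int set)"
    unfolding lessThan_2 by auto
  ultimately show ?thesis by (simp add: coeff_energy_def lessThan_2)
qed

lemma coeff_l2_mono:
  assumes "coeff_l2 c" "\<And>i k. \<bar>d i k\<bar> \<le> \<bar>c i k\<bar>"
  shows "coeff_l2 d"
  unfolding coeff_l2_def
proof (intro allI impI)
  fix i :: nat assume "i < 2"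
  with assms(1) have "(\<lambda>k. (c i k)\<^sup>2) summable_on UNIV" by (simp add: coeff_l2_def)
  then show "(\<lambda>k. (d i k)\<^sup>2) summable_on UNIV"
    by (rule summable_on_comparison_test) (use assms(2) in \<open>auto simp: abs_le_square_iff\<close>)
qed

lemma coeff_energy_tail:
  assumes c: "coeff_l2 c" and F: "finite F" "F \<subseteq> {..<2} \<times> UNIV"
  shows "coeff_energy (\<lambda>i k. coeff_restrict F c i k - c i k) = coeff_energy c - (\<Sum>(i, k)\<in>F. (c i k)\<^sup>2)"
proof -
  define d where "d i k = coeff_restrict F c i k - c i k" for i k
  have d: "coeff_l2 d"
    by (rule coeff_l2_mono[OF c]) (simp add: d_def coeff_restrict_def)
  have "((\<lambda>x. if x \<in> F then - (case x of (i, k) \<Rightarrow> (c i k)\<^sup>2) else 0) has_sum - (\<Sum>(i, k)\<in>F. (c i k)\<^sup>2))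
      ({..<2} \<times> UNIV)"
    by (rule has_sum_finite_neutralI[OF F]) (auto simp: sum_negf)
  from has_sum_add[OF coeff_energy_has_sum[OF c] this]
  have "((\<lambda>(i, k). (d i k)\<^sup>2) has_sum coeff_energy c + - (\<Sum>(i, k)\<in>F. (c i k)\<^sup>2)) ({..<2} \<times> UNIV)"
    by (rule has_sum_cong[THEN iffD1, rotated]) (auto simp: d_def coeff_restrict_def)
  then have "((\<lambda>(i, k). (d i k)\<^sup>2) has_sum coeff_energy c - (\<Sum>(i, k)\<in>F. (c i k)\<^sup>2)) ({..<2} \<times> UNIV)"
    by simp
  with coeff_energy_has_sum[OF d] show ?thesis
    unfolding d_def by (rule has_sum_unique)
qed

lemma coeff_l2_restrict:
  assumes "finite F"
  shows "coeff_l2 (coeff_restrict F c)"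
  unfolding coeff_l2_def
proof (intro allI impI)
  fix i :: nat
  have "(\<lambda>k. (coeff_restrict F c i k)\<^sup>2) summable_on UNIV \<longleftrightarrow>
      (\<lambda>k. (coeff_restrict F c i k)\<^sup>2) summable_on (snd ` F)"
    by (rule summable_on_cong_neutral) (force simp: coeff_restrict_def)+
  then show "(\<lambda>k. (coeff_restrict F c i k)\<^sup>2) summable_on UNIV"
    using assms by simp
qed

lemma L2_fun_hermite_term:
  assumes "x \<in> {..<2} \<times> UNIV"
  shows "L2_fun (hermite_term c x)"
proof -
  have "hermite_term c x = hermite_series (coeff_restrict {x} c)"
    using hermite_partial_sum[of "{x}" c] assms by auto
  then show ?thesis
    using hermite_series_bounds(1)[OF coeff_l2_restrict[of "{x}" c]] by simp
qed

text \<open>The remainder of a partial sum is the series of the omitted coefficients, whose energy tends to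
  zero.\<close>

lemma L2_has_sum_hermite:
  assumes c: "coeff_l2 c"
  shows "L2_has_sum (hermite_term c) (hermite_series c) ({..<2} \<times> UNIV)"
  unfolding L2_has_sum_def
proof (intro conjI ballI L2_fun_hermite_term)
  show "L2_fun (hermite_series c)" by (rule hermite_series_bounds(1)[OF c])
  define I where "I = {..<2::nat} \<times> (UNIV :: int set)"
  define r where "r F = coeff_energy c - (\<Sum>(i, k)\<in>F. (c i k)\<^sup>2)" for F
  have "((\<lambda>F. \<Sum>(i, k)\<in>F. (c i k)\<^sup>2) \<longlongrightarrow> coeff_energy c) (finite_subsets_at_top I)"
    using coeff_energy_has_sum[OF c] unfolding has_sum_def I_def .
  then have "(r \<longlongrightarrow> coeff_energy c - coeff_energy c) (finite_subsets_at_top I)"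
    unfolding r_def by (intro tendsto_intros)
  then have "((\<lambda>F. sqrt (2 * r F)) \<longlongrightarrow> sqrt (2 * 0)) (finite_subsets_at_top I)"
    by (intro tendsto_intros) simp
  then have lim: "((\<lambda>F. sqrt (2 * r F)) \<longlongrightarrow> 0) (finite_subsets_at_top I)" by simp
  have bound: "L2norm (\<lambda>t. (\<Sum>x\<in>F. hermite_term c x t) - hermite_series c t) \<le> sqrt (2 * r F)"
    if F: "finite F" "F \<subseteq> I" for F
  proof -
    define d where "d i k = coeff_restrict F c i k - c i k" for i k
    have d: "coeff_l2 d"
      by (rule coeff_l2_mono[OF c]) (simp add: d_def coeff_restrict_def)
    have "(\<Sum>x\<in>F. hermite_term c x t) - hermite_series c t = hermite_series d t" for t
      using hermite_partial_sum[of F c t] F by (simp add: hermite_series_diff d_def[abs_def] I_def)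
    then have "(L2norm (\<lambda>t. (\<Sum>x\<in>F. hermite_term c x t) - hermite_series c t))\<^sup>2 \<le> 2 * r F"
      using hermite_series_bounds(3)[OF d] coeff_energy_tail[OF c] F
      by (simp add: d_def[abs_def] r_def I_def)
    then show ?thesis by (rule real_le_rsqrt)
  qed
  show "((\<lambda>F. L2norm (\<lambda>t. (\<Sum>x\<in>F. hermite_term c x t) - hermite_series c t)) \<longlongrightarrow> 0)
      (finite_subsets_at_top ({..<2} \<times> UNIV))"
    unfolding I_def[symmetric]
  proof (rule tendsto_sandwich[OF _ _ tendsto_const lim])
    show "eventually (\<lambda>F. L2norm (\<lambda>t. (\<Sum>x\<in>F. hermite_term c x t) - hermite_series c t) \<le> sqrt (2 * r F))
        (finite_subsets_at_top I)"
      by (rule eventually_finite_subsets_at_top_weakI) (rule bound)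
    show "eventually (\<lambda>F. 0 \<le> L2norm (\<lambda>t. (\<Sum>x\<in>F. hermite_term c x t) - hermite_series c t))
        (finite_subsets_at_top I)"
      by (intro always_eventually allI) (simp add: L2norm_def)
  qed
qed

lemma riesz_basis_hermite: "riesz_basis_shifts [hermite1, hermite2]"
proof -
  have "\<exists>f. L2_has_sum (hermite_term c) f ({..<2} \<times> UNIV) \<and>
      1 / 2100 * coeff_energy c \<le> (L2norm f)\<^sup>2 \<and> (L2norm f)\<^sup>2 \<le> 2 * coeff_energy c"
    if "coeff_l2 c" for c
    using L2_has_sum_hermite[OF that] hermite_series_bounds[OF that] by blast
  then show ?thesis
    unfolding riesz_basis_shifts_def coeff_l2_def coeff_energy_def
    by (intro exI[of _ "1 / 2100"] exI[of _ 2]) (simp add: numeral_2_eq_2 del: sum.lessThan_Suc)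
qed

section \<open>Hermite expansions of the B-splines\<close>

text \<open>Hermite interpolation in the form required of a spline pair: the two generators are grouped by
  their common shift.\<close>

lemma L2_has_sum_hermite_pairs:
  assumes K: "finite K" "\<And>i k. k \<notin> K \<Longrightarrow> c i k = 0"
    and g: "integrable lborel g" "AE t in lborel. g t = hermite_series c t"
  shows "L2_has_sum (\<lambda>k t. c 0 k * hermite1 (t - of_int k) + c 1 k * hermite2 (t - of_int k)) g UNIV"
proof (rule L2_has_sum_finite[OF K(1)])
  show "L2_fun (\<lambda>t. c 0 k * hermite1 (t - of_int k) + c 1 k * hermite2 (t - of_int k))" for k
    using L2_fun_add[OF L2_fun_hermite_term[of "(0, k)" c] L2_fun_hermite_term[of "(1, k)" c]] by simp
  have "(\<Sum>k\<in>K. c 0 k * hermite1 (t - of_int k) + c 1 k * hermite2 (t - of_int k)) = hermite_series c t" for t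
  proof -
    have "coeff_restrict ({0, 1} \<times> K) c i k = c i k" if "i < 2" for i k
      using that K(2) by (auto simp: coeff_restrict_def)
    then have "hermite_series c t = hermite_series (coeff_restrict ({0, 1} \<times> K) c) t"
      by (simp add: hermite_series_def)
    also have "\<dots> = (\<Sum>x\<in>{0, 1} \<times> K. hermite_term c x t)"
      using K(1) by (intro hermite_partial_sum[symmetric]) auto
    also have "\<dots> = (\<Sum>i\<in>{0, 1}. \<Sum>k\<in>K. hermite_term c (i, k) t)"
      by (rule sum.cartesian_product')
    finally show ?thesis by (simp add: sum.distrib)
  qed
  then show "AE t in lborel. g t = (\<Sum>k\<in>K. c 0 k * hermite1 (t - of_int k) + c 1 k * hermite2 (t - of_int k))"
    using g(2) by simp
qed (use K g in auto)

text \<open>Values (\<open>i = 0\<close>) and slopes (\<open>i = 1\<close>) of the quadratic B-spline at the integers.\<close>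

definition bspl2_coeff :: "nat \<Rightarrow> int \<Rightarrow> real" where
  "bspl2_coeff i k =
     (if i = 0 then (if k = 1 \<or> k = 2 then 1 / 2 else 0)
      else (if k = 1 then 1 else if k = 2 then - 1 else 0))"

text \<open>Values (\<open>i = 0\<close>) and slopes (\<open>i = 1\<close>) of the cubic B-spline at the integers.\<close>

definition bspl3_coeff :: "nat \<Rightarrow> int \<Rightarrow> real" where
  "bspl3_coeff i k =
     (if i = 0 then (if k = 1 \<or> k = 3 then 1 / 6 else if k = 2 then 2 / 3 else 0)
      else (if k = 1 then 1 / 2 else if k = 3 then - 1 / 2 else 0))"

lemma bspl_eq_hermite_series:
  "bspl2 t = hermite_series bspl2_coeff t" "bspl3 t = hermite_series bspl3_coeff t"
proof -
  define n where "n = \<lfloor>t\<rfloor>"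
  define s where "s = t - of_int n"
  have s: "0 \<le> s" "s < 1" and t: "t = of_int n + s"
    unfolding s_def n_def using floor_correct[of t] by linarith+
  have series: "hermite_series c t = hermite_cell (c 0 n) (c 1 n) (c 0 (n + 1)) (c 1 (n + 1)) s" for c
    by (simp add: hermite_series_def n_def s_def)
  note defs = series hermite_cell_def
  consider "n \<le> -1" | "n \<ge> 4" | "n = 0" | "n = 1" | "n = 2" | "n = 3" by linarith
  then have "bspl2 t = hermite_series bspl2_coeff t \<and> bspl3 t = hermite_series bspl3_coeff t"
  proof cases
    case 1
    then have "real_of_int n \<le> -1" by linarith
    with s t have "t \<le> 0" by linarith
    with 1 show ?thesis
      by (simp add: defs bspl2_coeff_def bspl3_coeff_def bspl2_def bspl3_def trunc_pow_simps)
  next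
    case 2
    then have "real_of_int n \<ge> 4" by linarith
    with s t have "t \<ge> 4" by linarith
    with 2 show ?thesis
      by (simp add: defs bspl2_coeff_def bspl3_coeff_def bspl2_def bspl3_def trunc_pow_simps)
         (simp add: power2_eq_square power3_eq_cube algebra_simps)
  next
    case 3
    then have "t = s" using t by simp
    then show ?thesis
      unfolding series \<open>n = 0\<close> bspl2_def bspl3_def using s
      by (simp add: trunc_pow_simps bspl2_coeff_def bspl3_coeff_def hermite_cell_def)
         (simp add: power2_eq_square power3_eq_cube field_simps)
  next
    case 4
    then have "t = 1 + s" using t by simp
    then show ?thesis
      unfolding series \<open>n = 1\<close> bspl2_def bspl3_def using s
      by (simp add: trunc_pow_simps bspl2_coeff_def bspl3_coeff_def hermite_cell_def)
         (simp add: power2_eq_square power3_eq_cube field_simps)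
  next
    case 5
    then have "t = 2 + s" using t by simp
    then show ?thesis
      unfolding series \<open>n = 2\<close> bspl2_def bspl3_def using s
      by (simp add: trunc_pow_simps bspl2_coeff_def bspl3_coeff_def hermite_cell_def)
         (simp add: power2_eq_square power3_eq_cube field_simps)
  next
    case 6
    then have "t = 3 + s" using t by simp
    then show ?thesis
      unfolding series \<open>n = 3\<close> bspl2_def bspl3_def using s
      by (simp add: trunc_pow_simps bspl2_coeff_def bspl3_coeff_def hermite_cell_def)
         (simp add: power2_eq_square power3_eq_cube field_simps)
  qed
  then show "bspl2 t = hermite_series bspl2_coeff t" "bspl3 t = hermite_series bspl3_coeff t"
    by blast+
qed

theorem hermite_in_spline_pairs: "(hermite1, hermite2) \<in> spline_pairs"
proof -
  have L2: "L2_fun hermite1" "L2_fun hermite2"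
    using L2_fun_hermite_term[of "(0, 0)" "\<lambda>_ _. 1"] L2_fun_hermite_term[of "(1, 0)" "\<lambda>_ _. 1"]
    by simp_all
  let ?K = "{1, 2, 3 :: int}"
  have "(\<lambda>k. \<bar>real_of_int k\<bar> ^ 3 * (\<bar>bspl2_coeff 0 k\<bar> + \<bar>bspl2_coeff 1 k\<bar> + \<bar>bspl3_coeff 0 k\<bar> + \<bar>bspl3_coeff 1 k\<bar>))
      summable_on UNIV"
    by (rule summable_on_cong_neutral[where S="?K", THEN iffD1])
       (auto simp: bspl2_coeff_def bspl3_coeff_def)
  moreover have "L2_has_sum (\<lambda>k t. bspl2_coeff 0 k * hermite1 (t - of_int k) + bspl2_coeff 1 k * hermite2 (t - of_int k))
      (bspline 2) UNIV"
    by (rule L2_has_sum_hermite_pairs[where K="?K" and c=bspl2_coeff,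
          OF _ _ bspline2_AE(1) bspline2_AE(2)[unfolded bspl_eq_hermite_series]])
       (simp_all add: bspl2_coeff_def)
  moreover have "L2_has_sum (\<lambda>k t. bspl3_coeff 0 k * hermite1 (t - of_int k) + bspl3_coeff 1 k * hermite2 (t - of_int k))
      (bspline 3) UNIV"
    by (rule L2_has_sum_hermite_pairs[where K="?K" and c=bspl3_coeff,
          OF _ _ bspline3_AE(1) bspline3_AE(2)[unfolded bspl_eq_hermite_series]])
       (simp_all add: bspl3_coeff_def)
  ultimately show ?thesis
    unfolding spline_pairs_def mem_Collect_eq prod.case
    using L2 riesz_basis_hermite
    by (intro conjI exI[of _ "bspl2_coeff 0"] exI[of _ "bspl2_coeff 1"]
        exI[of _ "bspl3_coeff 0"] exI[of _ "bspl3_coeff 1"])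
qed

section \<open>Support size\<close>

text \<open>By the Lindelof property countably many of the open null regions already cover their union.\<close>

lemma AE_zero_outside_ess_supp: "AE t in lborel. t \<notin> ess_supp f \<longrightarrow> f t = 0"
proof -
  define \<U> where "\<U> = {U. open U \<and> (AE t in lborel. t \<in> U \<longrightarrow> f t = 0)}"
  obtain \<V> where V: "\<V> \<subseteq> \<U>" "countable \<V>" "\<Union>\<V> = \<Union>\<U>"
    using Lindelof[of \<U>] by (auto simp: \<U>_def)
  have "AE t in lborel. \<forall>U\<in>\<V>. t \<in> U \<longrightarrow> f t = 0"
    using V(1) by (subst AE_ball_countable[OF V(2)]) (auto simp: \<U>_def)
  then show ?thesis
  proof eventually_elim
    case (elim t)
    then show ?case using V(3) by (auto simp: ess_supp_def \<U>_def[symmetric])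
  qed
qed

lemma supp_size_le:
  assumes "a \<le> b" "\<And>t. t \<notin> {a..b} \<Longrightarrow> f t = 0"
  shows "supp_size f \<le> ennreal (b - a)"
  unfolding supp_size_def using assms(1) ess_supp_subsetI[of a b f, OF assms(2)]
  by (intro Inf_lower) blast

lemma supp_size_lessD:
  assumes "supp_size f < ennreal r"
  obtains a b where "a \<le> b" "b - a < r" "AE t in lborel. t \<notin> {a..b} \<longrightarrow> f t = 0"
proof -
  obtain a b where ab: "a \<le> b" "ess_supp f \<subseteq> {a..b}" "ennreal (b - a) < ennreal r"
    using assms unfolding supp_size_def Inf_less_iff by blast
  have "AE t in lborel. t \<notin> {a..b} \<longrightarrow> f t = 0"
    using AE_zero_outside_ess_supp[of f] by eventually_elim (use ab(2) in blast)
  with ab that show thesis by (simp add: ennreal_less_iff)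
qed

text \<open>The slack below \<open>r\<close> is divided equally between the two infima.\<close>

lemma supp_size_add_lessD:
  assumes "supp_size f + supp_size g < ennreal r"
  obtains a b a' b' where "a \<le> b" "a' \<le> b'" "(b - a) + (b' - a') < r"
    "AE t in lborel. t \<notin> {a..b} \<longrightarrow> f t = 0" "AE t in lborel. t \<notin> {a'..b'} \<longrightarrow> g t = 0"
proof -
  have "supp_size f < top" "supp_size g < top"
    using assms by (auto simp: less_top[symmetric] top_unique)
  then obtain x y where x: "supp_size f = ennreal x" "x \<ge> 0" and y: "supp_size g = ennreal y" "y \<ge> 0"
    by (metis enn2real_nonneg ennreal_enn2real)
  then have "ennreal (x + y) < ennreal r"
    using assms by (simp add: ennreal_plus[symmetric] del: ennreal_plus)
  then have "x + y < r" using x y by (subst (asm) ennreal_less_iff) auto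
  define e where "e = (r - (x + y)) / 2"
  have e: "e > 0" "x + e + (y + e) = r" using \<open>x + y < r\<close> by (auto simp: e_def field_simps)
  have "supp_size f < ennreal (x + e)" "supp_size g < ennreal (y + e)"
    using x y e by (simp_all add: ennreal_less_iff)
  then show thesis
    using that e(2) by (elim supp_size_lessD) (smt (verit))
qed

section \<open>Counting active shifts\<close>

lemma card_int_Icc_le:
  assumes "u \<le> (v::real)"
  shows "finite {m::int. u \<le> m \<and> m \<le> v}" and "real (card {m::int. u \<le> m \<and> m \<le> v}) \<le> v - u + 1"
proof -
  have eq: "{m::int. u \<le> m \<and> m \<le> v} = {\<lceil>u\<rceil>..\<lfloor>v\<rfloor>}"
    by (auto simp: ceiling_le_iff le_floor_iff)
  then show "finite {m::int. u \<le> m \<and> m \<le> v}" by simp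
  have "real (nat (\<lfloor>v\<rfloor> - \<lceil>u\<rceil> + 1)) \<le> v - u + 1"
    using assms by linarith
  then show "real (card {m::int. u \<le> m \<and> m \<le> v}) \<le> v - u + 1"
    by (simp add: eq algebra_simps)
qed

text \<open>The pairs \<open>(i, k)\<close> for which the shift by \<open>k\<close> of the interval \<open>[lo i, hi i]\<close> contains \<open>x\<close>.\<close>

definition active_shifts :: "nat \<Rightarrow> (nat \<Rightarrow> real) \<Rightarrow> (nat \<Rightarrow> real) \<Rightarrow> real \<Rightarrow> (nat \<times> int) set" where
  "active_shifts N lo hi x = {(i, k). i < N \<and> x - of_int k \<in> {lo i..hi i}}"

lemma active_shifts_altdef:
  "active_shifts N lo hi x = (SIGMA i:{..<N}. {k. x - hi i \<le> of_int k \<and> of_int k \<le> x - lo i})"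
  by (auto simp: active_shifts_def algebra_simps)

lemma finite_active_shifts:
  assumes "\<And>i. i < N \<Longrightarrow> lo i \<le> hi i"
  shows "finite (active_shifts N lo hi x)"
  unfolding active_shifts_altdef using assms by (intro finite_SigmaI card_int_Icc_le(1)) auto

text \<open>A Riemann sum for the average number of integer shifts of \<open>[lo, hi]\<close> that cover a point: the map
  \<open>(j, k) \<mapsto> j - k M\<close> is injective, since \<open>j\<close> is a residue modulo \<open>M\<close>, and sends the incidences to
  integers between \<open>M lo\<close> and \<open>M hi\<close>.\<close>

lemma sum_card_shifts_le:
  assumes "lo \<le> (hi::real)" and M: "M > 0"
  shows "real (\<Sum>j<M. card {k::int. real j / M - hi \<le> k \<and> k \<le> real j / M - lo}) \<le> M * (hi - lo) + 1"
proof -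
  let ?A = "\<lambda>j. {k::int. real j / M - hi \<le> k \<and> k \<le> real j / M - lo}"
  let ?B = "{m::int. M * lo \<le> m \<and> m \<le> M * hi}"
  have B: "M * lo \<le> M * hi" using assms by simp
  have fin: "finite (?A j)" for j using assms by (intro card_int_Icc_le(1)) auto
  have "(\<Sum>j<M. card (?A j)) = card (SIGMA j:{..<M}. ?A j)"
    using fin by (intro card_SigmaI[symmetric]) auto
  also have "\<dots> \<le> card ?B"
  proof (rule card_inj_on_le[where f="\<lambda>(j, k). int j - k * int M"])
    show "inj_on (\<lambda>(j, k). int j - k * int M) (SIGMA j:{..<M}. ?A j)"
    proof (rule inj_onI)
      fix p q assume p: "p \<in> (SIGMA j:{..<M}. ?A j)" and q: "q \<in> (SIGMA j:{..<M}. ?A j)"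
        and eq: "(case p of (j, k) \<Rightarrow> int j - k * int M) = (case q of (j, k) \<Rightarrow> int j - k * int M)"
      obtain j k j' k' where pq: "p = (j, k)" "q = (j', k')" by (cases p, cases q)
      have "(int j - k * int M) mod int M = int j" "(int j' - k' * int M) mod int M = int j'"
        using p q by (simp_all add: pq mod_diff_eq[of _ "int M" "_ * int M", symmetric])
      with eq have "int j = int j'" by (simp only: pq prod.case)
      with eq M show "p = q" by (simp add: pq)
    qed
    show "(\<lambda>(j, k). int j - k * int M) ` (SIGMA j:{..<M}. ?A j) \<subseteq> ?B"
      using M by (auto simp: field_simps)
    show "finite ?B" by (rule card_int_Icc_le(1)[OF B])
  qed
  finally have "real (\<Sum>j<M. card (?A j)) \<le> real (card ?B)" by (simp only: of_nat_le_iff)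
  also have "\<dots> \<le> M * hi - M * lo + 1" by (rule card_int_Icc_le(2)[OF B])
  finally show ?thesis by (simp add: algebra_simps)
qed

text \<open>If at least \<open>m\<close> shifts were active everywhere, then summing over the \<open>M\<close> points \<open>j / M\<close> would give
  \<open>M m \<le> M L + N\<close> for the total length \<open>L < m\<close>, which fails for large \<open>M\<close>.\<close>

lemma ex_few_active_shifts:
  assumes le: "\<And>i. i < N \<Longrightarrow> lo i \<le> hi i" and total: "(\<Sum>i<N. hi i - lo i) < real m"
  shows "\<exists>x. card (active_shifts N lo hi x) < m"
proof (rule ccontr)
  assume "\<not> ?thesis"
  then have ge: "m \<le> card (active_shifts N lo hi x)" for x by (simp add: not_less)
  define L where "L = (\<Sum>i<N. hi i - lo i)"
  obtain M :: nat where M: "real N / (real m - L) < M" using reals_Archimedean2 by blast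
  have L: "real m - L > 0" using total by (simp add: L_def)
  moreover have "0 \<le> real N / (real m - L)" using L by simp
  ultimately have M0: "M > 0" using M by linarith
  have "real M * real m \<le> real (\<Sum>j<M. card (active_shifts N lo hi (j / M)))"
    using sum_mono[of "{..<M}" "\<lambda>_. m" "\<lambda>j. card (active_shifts N lo hi (j / M))"] ge
    by (simp flip: of_nat_mult add: of_nat_le_iff del: of_nat_sum)
  also have "(\<Sum>j<M. card (active_shifts N lo hi (j / M))) =
      (\<Sum>j<M. \<Sum>i<N. card {k::int. real j / M - hi i \<le> k \<and> k \<le> real j / M - lo i})"
    unfolding active_shifts_altdef using le
    by (intro sum.cong refl card_SigmaI) (auto intro!: card_int_Icc_le(1))
  also have "\<dots> = (\<Sum>i<N. \<Sum>j<M. card {k::int. real j / M - hi i \<le> k \<and> k \<le> real j / M - lo i})"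
    by (rule sum.swap)
  also have "real \<dots> = (\<Sum>i<N. real (\<Sum>j<M. card {k::int. real j / M - hi i \<le> k \<and> k \<le> real j / M - lo i}))"
    by simp
  also have "\<dots> \<le> (\<Sum>i<N. M * (hi i - lo i) + 1)"
    using le M0 by (intro sum_mono sum_card_shifts_le) auto
  also have "\<dots> = M * L + N"
    by (simp add: L_def sum.distrib sum_distrib_left)
  finally have "real M * (real m - L) \<le> real N" by (simp add: algebra_simps)
  moreover have "real N < real M * (real m - L)"
    using M L by (simp add: pos_divide_less_eq)
  ultimately show False by simp
qed

lemma ex_interval_few_active_shifts:
  assumes le: "\<And>i. i < N \<Longrightarrow> lo i \<le> hi i" and total: "(\<Sum>i<N. hi i - lo i) < real m"
  obtains n :: int and u v :: real and S :: "(nat \<times> int) set"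
  where "of_int n \<le> u" "u < v" "v \<le> of_int n + 1" "finite S" "card S < m"
    "\<And>t. u < t \<Longrightarrow> t < v \<Longrightarrow> active_shifts N lo hi t \<subseteq> S"
proof -
  obtain x where x: "card (active_shifts N lo hi x) < m"
    using ex_few_active_shifts[OF le total] by blast
  \<comment> \<open>Moving right from \<open>x\<close>, a shift \<open>(i, k)\<close> can only become active at \<open>lo i + k\<close>.\<close>
  define V where "V = insert (of_int \<lfloor>x\<rfloor> + 1) ((\<lambda>i. lo i + of_int \<lfloor>x - lo i\<rfloor> + 1) ` {..<N})"
  define v where "v = Min V"
  have V: "finite V" "V \<noteq> {}" by (auto simp: V_def)
  have "x < y" if "y \<in> V" for y using that by (auto simp: V_def) linarith+
  then have "x < v" using V by (simp add: v_def)
  moreover have "v \<le> of_int \<lfloor>x\<rfloor> + 1" using V by (simp add: v_def V_def)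
  moreover have "active_shifts N lo hi t \<subseteq> active_shifts N lo hi x" if t: "x < t" "t < v" for t
  proof clarify
    fix i k assume "(i, k) \<in> active_shifts N lo hi t"
    then have i: "i < N" and k: "lo i \<le> t - of_int k" "t - of_int k \<le> hi i"
      by (auto simp: active_shifts_def)
    have "v \<le> lo i + of_int \<lfloor>x - lo i\<rfloor> + 1" using V i by (simp add: v_def V_def)
    then have "real_of_int k < real_of_int (\<lfloor>x - lo i\<rfloor> + 1)" using k(1) t(2) by simp
    then have "k \<le> \<lfloor>x - lo i\<rfloor>" by linarith
    then have "real_of_int k \<le> x - lo i" by (simp add: le_floor_iff)
    then show "(i, k) \<in> active_shifts N lo hi x"
      using i k t(1) by (auto simp: active_shifts_def)
  qed
  ultimately show thesis
    using x finite_active_shifts[of N lo hi x] le of_int_floor_le[of x]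
    by (intro that[of "\<lfloor>x\<rfloor>" x v "active_shifts N lo hi x"]) auto
qed

section \<open>Linear dependency on an interval with few active shifts\<close>

text \<open>Gaussian elimination: more vectors \<open>V j\<close> than coordinates in \<open>S\<close>.\<close>

lemma ex_linear_dependency:
  fixes V :: "'j \<Rightarrow> 's \<Rightarrow> 'a::field"
  assumes "finite S" "finite J" "card S < card J"
  shows "\<exists>l. (\<exists>j\<in>J. l j \<noteq> 0) \<and> (\<forall>x\<in>S. (\<Sum>j\<in>J. l j * V j x) = 0)"
  using assms
proof (induction S arbitrary: J V rule: finite_induct)
  case empty
  then have "J \<noteq> {}" by auto
  then show ?case by (intro exI[of _ "\<lambda>_. 1"]) auto
next
  case (insert x S)
  show ?case
  proof (cases "\<forall>j\<in>J. V j x = 0")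
    case True
    have "card S < card J" using insert by simp
    from insert.IH[OF insert.prems(1) this, of V] True show ?thesis by force
  next
    case False
    then obtain p where p: "p \<in> J" "V p x \<noteq> 0" by blast
    define W where "W j y = V j y - V j x / V p x * V p y" for j y
    have "card S < card (J - {p})" using insert p by simp
    from insert.IH[OF finite_Diff[OF insert.prems(1)] this, of W]
    obtain l where l: "\<exists>j\<in>J - {p}. l j \<noteq> 0" "\<forall>y\<in>S. (\<Sum>j\<in>J - {p}. l j * W j y) = 0" by blast
    define l' where "l' = l(p := - (\<Sum>j\<in>J - {p}. l j * V j x / V p x))"
    have l': "(\<Sum>j\<in>J. l' j * V j y) = (\<Sum>j\<in>J - {p}. l j * W j y)" for y
    proof -
      have "(\<Sum>j\<in>J. l' j * V j y) = l' p * V p y + (\<Sum>j\<in>J - {p}. l' j * V j y)"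
        using insert.prems(1) p(1) by (rule sum.remove)
      also have "(\<Sum>j\<in>J - {p}. l' j * V j y) = (\<Sum>j\<in>J - {p}. l j * V j y)"
        by (intro sum.cong) (auto simp: l'_def)
      finally show ?thesis
        by (simp add: l'_def W_def right_diff_distrib sum_subtractf sum_distrib_right mult.assoc)
    qed
    have "W j x = 0" for j using p(2) by (simp add: W_def)
    then have "\<forall>y\<in>insert x S. (\<Sum>j\<in>J. l' j * V j y) = 0"
      using l(2) by (simp add: l')
    moreover have "\<exists>j\<in>J. l' j \<noteq> 0" using l(1) by (auto simp: l'_def)
    ultimately show ?thesis by blast
  qed
qed

text \<open>The property may be nonmeasurable; what is shifted is a Borel null set that contains its
  exceptions.\<close>

lemma AE_lborel_shift:
  fixes P :: "real \<Rightarrow> bool"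
  assumes "AE t in lborel. P t"
  shows "AE t in lborel. P (t - c)"
proof -
  obtain N where N: "{t \<in> space lborel. \<not> P t} \<subseteq> N" "N \<in> null_sets lborel"
    using assms by (auto simp: eventually_ae_filter)
  have "AE t in lborel. t \<notin> N" using N(2) by (rule AE_not_in)
  moreover have "Measurable.pred borel (\<lambda>t. t \<notin> N)"
    using N(2) by (intro pred_intros_logic) (auto dest: null_setsD2)
  ultimately have "AE t in lborel. - c + 1 * t \<notin> N"
    by (intro AE_borel_affine) auto
  then show ?thesis
    by eventually_elim (use N(1) in \<open>auto simp: add.commute\<close>)
qed

text \<open>Once a finite index set contains \<open>S\<close>, its partial sum no longer changes on \<open>T\<close>. The squared error
  over \<open>T\<close> is thus a constant bounded by quantities that tend to zero.\<close>

lemma L2_has_sum_AE_local: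
  assumes sum: "L2_has_sum f g I" and S: "finite S" "S \<subseteq> I" and T: "T \<in> sets borel"
    and zero: "\<And>i. i \<in> I - S \<Longrightarrow> AE t in lborel. t \<in> T \<longrightarrow> f i t = 0"
  shows "AE t in lborel. t \<in> T \<longrightarrow> g t = (\<Sum>i\<in>S. f i t)"
proof -
  have f: "L2_fun (f i)" if "i \<in> I" for i using sum that by (simp add: L2_has_sum_def)
  have g: "L2_fun g" using sum by (simp add: L2_has_sum_def)
  define h where "h F t = (\<Sum>i\<in>F. f i t) - g t" for F t
  have h: "L2_fun (h F)" if "F \<subseteq> I" for F
    unfolding h_def using that by (intro L2_fun_diff L2_fun_sum f g) auto
  have [measurable]: "h S \<in> borel_measurable borel" "T \<in> sets borel"
    using h[OF S(2)] T by (auto dest: L2_fun_measurable)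
  let ?D = "\<integral>\<^sup>+t. ennreal ((h S t)\<^sup>2) * indicator T t \<partial>lborel"
  have "?D \<le> ennreal ((L2norm (h F))\<^sup>2)" if F: "finite F" "S \<subseteq> F" "F \<subseteq> I" for F
  proof -
    have "AE t in lborel. \<forall>i\<in>F - S. t \<in> T \<longrightarrow> f i t = 0"
      using F by (intro AE_finite_allI zero) auto
    then have "AE t in lborel. ennreal ((h S t)\<^sup>2) * indicator T t \<le> ennreal ((h F t)\<^sup>2)"
    proof eventually_elim
      case (elim t)
      show ?case
      proof (cases "t \<in> T")
        case True
        then have "(\<Sum>i\<in>F. f i t) = (\<Sum>i\<in>S. f i t)"
          using F elim by (intro sum.mono_neutral_right) auto
        then show ?thesis using True by (simp add: h_def)
      qed simp
    qed
    then have "?D \<le> (\<integral>\<^sup>+t. ennreal ((h F t)\<^sup>2) \<partial>lborel)" by (rule nn_integral_mono_AE)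
    then show ?thesis by (simp only: nn_integral_eq_L2norm[OF h[OF F(3)]])
  qed
  then have "eventually (\<lambda>F. ?D \<le> ennreal ((L2norm (h F))\<^sup>2)) (finite_subsets_at_top I)"
    using S unfolding eventually_finite_subsets_at_top by (intro exI[of _ S]) auto
  moreover have "((\<lambda>F. ennreal ((L2norm (h F))\<^sup>2)) \<longlongrightarrow> ennreal (0\<^sup>2)) (finite_subsets_at_top I)"
    using sum unfolding L2_has_sum_def h_def by (intro tendsto_ennrealI tendsto_power) blast
  ultimately have "?D \<le> ennreal (0\<^sup>2)"
    by (intro tendsto_lowerbound) auto
  then have "?D = 0" by simp
  then have "AE t in lborel. ennreal ((h S t)\<^sup>2) * indicator T t = 0"
    by (subst (asm) nn_integral_0_iff_AE) auto
  then show ?thesis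
    by eventually_elim (auto simp: h_def)
qed

text \<open>The shift of \<open>g\<close> by \<open>q\<close> is expanded near \<open>t\<close> in the same active functions as \<open>g\<close> itself; only the
  coefficients move.\<close>

lemma shift_expansion_local:
  assumes sum: "L2_has_sum (\<lambda>k t. \<Sum>i<N. c i k * \<phi> i (t - of_int k)) g UNIV"
    and supp: "\<And>i. i < N \<Longrightarrow> AE t in lborel. t \<notin> {lo i..hi i} \<longrightarrow> \<phi> i t = 0"
    and S: "finite S" and active: "\<And>t. u < t \<Longrightarrow> t < v \<Longrightarrow> active_shifts N lo hi t \<subseteq> S"
  shows "AE t in lborel. u < t \<and> t < v \<longrightarrow>
      g (t - of_int q) = (\<Sum>(i, k)\<in>S \<inter> {..<N} \<times> UNIV. c i (k - q) * \<phi> i (t - of_int k))"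
proof -
  have term0: "AE t in lborel. u - of_int q < t \<and> t < v - of_int q \<longrightarrow> \<phi> i (t - of_int k) = 0"
    if "i < N" "(i, k + q) \<notin> S" for i k
    using AE_lborel_shift[OF supp[OF that(1)], of "of_int k"]
  proof eventually_elim
    case (elim t)
    show ?case
    proof
      assume t: "u - of_int q < t \<and> t < v - of_int q"
      then have "(i, k + q) \<notin> active_shifts N lo hi (t + of_int q)"
        using active[of "t + of_int q"] that by auto
      then have "t - of_int k \<notin> {lo i..hi i}" using that by (auto simp: active_shifts_def)
      with elim show "\<phi> i (t - of_int k) = 0" by blast
    qed
  qed
  define K where "K = (\<lambda>x. snd x - q) ` S"
  have K: "finite K" unfolding K_def using S by simp
  have inK: "k \<in> K" if "(i, k + q) \<in> S" for i k
    unfolding K_def using that by force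
  let ?R = "{..<N} \<times> K"
  have "AE t in lborel. t \<in> {u - of_int q<..<v - of_int q} \<longrightarrow> g t = (\<Sum>k\<in>K. \<Sum>i<N. c i k * \<phi> i (t - of_int k))"
  proof (rule L2_has_sum_AE_local[OF sum K])
    fix k assume "k \<in> UNIV - K"
    then have "AE t in lborel. \<forall>i\<in>{..<N}. u - of_int q < t \<and> t < v - of_int q \<longrightarrow> \<phi> i (t - of_int k) = 0"
      using inK by (intro AE_finite_allI term0) auto
    then show "AE t in lborel. t \<in> {u - of_int q<..<v - of_int q} \<longrightarrow> (\<Sum>i<N. c i k * \<phi> i (t - of_int k)) = 0"
      by eventually_elim auto
  qed auto
  moreover have "AE t in lborel. \<forall>(i, k)\<in>?R. (i, k + q) \<notin> S \<longrightarrow>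
      u - of_int q < t \<and> t < v - of_int q \<longrightarrow> \<phi> i (t - of_int k) = 0"
  proof (rule AE_finite_allI)
    fix x assume "x \<in> ?R"
    then show "AE t in lborel. case x of (i, k) \<Rightarrow> (i, k + q) \<notin> S \<longrightarrow>
      u - of_int q < t \<and> t < v - of_int q \<longrightarrow> \<phi> i (t - of_int k) = 0"
      using term0 by (cases x; cases "(fst x, snd x + q) \<in> S") auto
  qed (use K in simp)
  ultimately have "AE t in lborel. u - of_int q < t \<and> t < v - of_int q \<longrightarrow>
      g t = (\<Sum>(i, k)\<in>S \<inter> {..<N} \<times> UNIV. c i (k - q) * \<phi> i (t - of_int (k - q)))"
  proof eventually_elim
    case (elim t)
    show ?case
    proof
      assume t: "u - of_int q < t \<and> t < v - of_int q"
      have "g t = (\<Sum>k\<in>K. \<Sum>i<N. c i k * \<phi> i (t - of_int k))"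
        using elim(1) t by simp
      also have "\<dots> = (\<Sum>(i, k)\<in>?R. c i k * \<phi> i (t - of_int k))"
        by (subst sum.swap) (rule sum.cartesian_product)
      also have "\<dots> = (\<Sum>(i, k)\<in>{(i, k)\<in>?R. (i, k + q) \<in> S}. c i k * \<phi> i (t - of_int k))"
      proof -
        have "(i, k + q) \<in> S" if "i < N" "k \<in> K" "\<phi> i (t - of_int k) \<noteq> 0" for i k
          using elim(2) t that by blast
        then show ?thesis using K by (intro sum.mono_neutral_right) auto
      qed
      also have "\<dots> = (\<Sum>(i, k)\<in>S \<inter> {..<N} \<times> UNIV. c i (k - q) * \<phi> i (t - of_int (k - q)))"
        by (rule sum.reindex_bij_witness[of _ "\<lambda>(i, k). (i, k - q)" "\<lambda>(i, k). (i, k + q)"])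
           (auto intro: inK)
      finally show "g t = (\<Sum>(i, k)\<in>S \<inter> {..<N} \<times> UNIV. c i (k - q) * \<phi> i (t - of_int (k - q)))" .
    qed
  qed
  from AE_lborel_shift[OF this, of "of_int q"] show ?thesis
    by eventually_elim auto
qed

text \<open>Below total support size \<open>m\<close>, any \<open>m\<close> consecutive shifts of a reproduced function \<open>g\<close> become
  dependent on some interval, as they are combinations of fewer than \<open>m\<close> active functions there. The
  interval lies in a unit cell, so that a spline \<open>g\<close> is polynomial on it.\<close>

theorem small_support_imp_local_dependency:
  fixes \<phi> :: "nat \<Rightarrow> real \<Rightarrow> real"
  assumes sum: "L2_has_sum (\<lambda>k t. \<Sum>i<N. c i k * \<phi> i (t - of_int k)) g UNIV"
    and le: "\<And>i. i < N \<Longrightarrow> lo i \<le> hi i"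
    and supp: "\<And>i. i < N \<Longrightarrow> AE t in lborel. t \<notin> {lo i..hi i} \<longrightarrow> \<phi> i t = 0"
    and total: "(\<Sum>i<N. hi i - lo i) < real m"
  obtains n :: int and u v l where "of_int n \<le> u" "u < v" "v \<le> of_int n + 1" "\<exists>j<m. l j \<noteq> 0"
    "AE t in lborel. u < t \<and> t < v \<longrightarrow> (\<Sum>j<m. l j * g (t - of_int n + real j)) = 0"
proof -
  obtain n u v S where I: "of_int n \<le> u" "u < v" "v \<le> of_int n + 1" and S: "finite S" "card S < m"
    and active: "\<And>t. u < t \<Longrightarrow> t < v \<Longrightarrow> active_shifts N lo hi t \<subseteq> S"
    using ex_interval_few_active_shifts[OF le total] by metis
  define q where "q j = n - int j" for j :: nat
  define S' where "S' = S \<inter> {..<N} \<times> UNIV"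
  have "card S' \<le> card S" unfolding S'_def using S by (intro card_mono) auto
  with S have "finite S'" "card S' < card {..<m}" by (auto simp: S'_def)
  from ex_linear_dependency[OF this(1) _ this(2), of "\<lambda>j (i, k). c i (k - q j)"]
  obtain l where l: "\<exists>j<m. l j \<noteq> 0" "\<forall>(i, k)\<in>S'. (\<Sum>j<m. l j * c i (k - q j)) = 0"
    by fastforce
  have "AE t in lborel. \<forall>j\<in>{..<m}. u < t \<and> t < v \<longrightarrow>
      g (t - of_int (q j)) = (\<Sum>(i, k)\<in>S'. c i (k - q j) * \<phi> i (t - of_int k))"
    unfolding S'_def by (intro AE_finite_allI shift_expansion_local[OF sum supp S(1) active]) auto
  then have "AE t in lborel. u < t \<and> t < v \<longrightarrow> (\<Sum>j<m. l j * g (t - of_int n + real j)) = 0"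
  proof eventually_elim
    case (elim t)
    show ?case
    proof
      assume t: "u < t \<and> t < v"
      have "(\<Sum>j<m. l j * g (t - of_int n + real j)) = (\<Sum>j<m. l j * g (t - of_int (q j)))"
        by (simp add: q_def algebra_simps)
      also have "\<dots> = (\<Sum>j<m. \<Sum>(i, k)\<in>S'. l j * c i (k - q j) * \<phi> i (t - of_int k))"
        using elim t by (intro sum.cong) (auto simp: sum_distrib_left case_prod_unfold mult.assoc)
      also have "\<dots> = (\<Sum>(i, k)\<in>S'. (\<Sum>j<m. l j * c i (k - q j)) * \<phi> i (t - of_int k))"
        by (subst sum.swap) (simp add: sum_distrib_right case_prod_unfold)
      also have "\<dots> = 0" using l(2) by (intro sum.neutral) auto
      finally show "(\<Sum>j<m. l j * g (t - of_int n + real j)) = 0" .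
    qed
  qed
  with I l(1) show thesis by (rule that)
qed

text \<open>Passes from almost everywhere to enough points for a polynomial to vanish.\<close>

lemma AE_interval_imp_infinite:
  fixes u v :: real
  assumes "u < v" "AE t in lborel. u < t \<and> t < v \<longrightarrow> P t"
  shows "infinite {t. P t}"
proof
  assume fin: "finite {t. P t}"
  then have "AE t in lborel. t \<notin> {t. P t}"
    by (intro AE_not_in finite_imp_null_set_lborel)
  with assms(2) have "AE t in lborel. t \<notin> {u<..<v}"
    by eventually_elim auto
  then have "{u<..<v} \<in> null_sets lborel"
    by (subst (asm) AE_iff_null_sets[symmetric]) auto
  then show False using assms(1) by (simp add: null_sets_def)
qed

section \<open>Minimal support of the Hermite pair\<close>

text \<open>The coefficients collect the four polynomial pieces of the cubic B-spline by powers of \<open>s\<close>.\<close>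

lemma bspl3_pieces:
  assumes "0 < s" "s < 1"
  shows "(\<Sum>j<4. l j * bspl3 (s + real j)) =
    poly [:(l 1 + 4 * l 2 + l 3) / 6, (l 1 - l 3) / 2, (l 1 - 2 * l 2 + l 3) / 2,
           (l 0 - 3 * l 1 + 3 * l 2 - l 3) / 6:] s"
proof -
  have "bspl3 s = s ^ 3 / 6" "bspl3 (s + 1) = (1 + 3 * s + 3 * s ^ 2 - 3 * s ^ 3) / 6"
    "bspl3 (s + 2) = (4 - 6 * s ^ 2 + 3 * s ^ 3) / 6" "bspl3 (s + 3) = (1 - s) ^ 3 / 6"
    unfolding bspl3_def using assms
    by (simp_all add: trunc_pow_simps, simp_all add: power2_eq_square power3_eq_cube algebra_simps)
  note pieces = this
  have "{..<4::nat} = {0, 1, 2, 3}" by auto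
  then have "(\<Sum>j<4. l j * bspl3 (s + real j)) =
      l 0 * bspl3 s + l 1 * bspl3 (s + 1) + l 2 * bspl3 (s + 2) + l 3 * bspl3 (s + 3)"
    by simp
  then show ?thesis
    unfolding pieces by (simp add: power2_eq_square power3_eq_cube field_simps)
qed

text \<open>A vanishing combination of the pieces is a cubic with infinitely many zeros, so its coefficients
  are zero, and these determine the four weights.\<close>

lemma bspline3_shifts_independent:
  assumes "of_int n \<le> u" "u < v" "v \<le> of_int n + 1"
    and dep: "AE t in lborel. u < t \<and> t < v \<longrightarrow> (\<Sum>j<4. l j * bspline 3 (t - of_int n + real j)) = 0"
    and j: "j < 4"
  shows "l j = 0"
proof -
  define p where "p = [:(l 1 + 4 * l 2 + l 3) / 6, (l 1 - l 3) / 2, (l 1 - 2 * l 2 + l 3) / 2,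
           (l 0 - 3 * l 1 + 3 * l 2 - l 3) / 6:]"
  have "AE t in lborel. \<forall>j\<in>{..<4}. bspline 3 (t - (of_int n - real j)) = bspl3 (t - (of_int n - real j))"
    by (intro AE_finite_allI AE_lborel_shift[OF bspline3_AE(2)]) auto
  with dep have "AE t in lborel. u < t \<and> t < v \<longrightarrow> poly p (t - of_int n) = 0"
  proof eventually_elim
    case (elim t)
    show ?case
    proof
      assume t: "u < t \<and> t < v"
      have "bspline 3 (t - of_int n + real j) = bspl3 (t - of_int n + real j)" if "j < 4" for j
        using elim(2) that by (simp add: algebra_simps)
      then have "(\<Sum>j<4. l j * bspl3 (t - of_int n + real j)) = 0"
        using elim(1) t by simp
      then show "poly p (t - of_int n) = 0"
        unfolding p_def using t assms(1-3) by (subst (asm) bspl3_pieces) auto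
    qed
  qed
  then have "infinite {t. poly p (t - of_int n) = 0}"
    by (rule AE_interval_imp_infinite[OF assms(2)])
  moreover have "{t. poly p (t - of_int n) = 0} \<subseteq> (\<lambda>s. s + of_int n) ` {s. poly p s = 0}"
  proof
    fix t assume "t \<in> {t. poly p (t - of_int n) = 0}"
    then show "t \<in> (\<lambda>s. s + of_int n) ` {s. poly p s = 0}"
      by (intro image_eqI[of _ _ "t - of_int n"]) auto
  qed
  ultimately have "infinite {s. poly p s = 0}"
    using finite_imageI finite_subset by blast
  then have "p = 0" using poly_roots_finite by blast
  then have "l 1 + 4 * l 2 + l 3 = 0" "l 1 = l 3" "l 1 - 2 * l 2 + l 3 = 0" "l 0 - 3 * l 1 + 3 * l 2 - l 3 = 0"
    by (simp_all add: p_def)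
  then have "l 0 = 0" "l 1 = 0" "l 2 = 0" "l 3 = 0" by linarith+
  moreover have "j = 0 \<or> j = 1 \<or> j = 2 \<or> j = 3" using j by linarith
  ultimately show ?thesis by blast
qed

theorem spline_pairs_support_ge:
  assumes "(\<phi>\<^sub>1, \<phi>\<^sub>2) \<in> spline_pairs"
  shows "4 \<le> supp_size \<phi>\<^sub>1 + supp_size \<phi>\<^sub>2"
proof (rule ccontr)
  assume "\<not> ?thesis"
  then have "supp_size \<phi>\<^sub>1 + supp_size \<phi>\<^sub>2 < ennreal 4" by (simp add: not_le)
  then obtain a b a' b' where ab: "a \<le> b" "a' \<le> b'" "(b - a) + (b' - a') < 4"
    and supp: "AE t in lborel. t \<notin> {a..b} \<longrightarrow> \<phi>\<^sub>1 t = 0" "AE t in lborel. t \<notin> {a'..b'} \<longrightarrow> \<phi>\<^sub>2 t = 0"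
    by (rule supp_size_add_lessD)
  obtain c d where "L2_has_sum (\<lambda>k t. c k * \<phi>\<^sub>1 (t - of_int k) + d k * \<phi>\<^sub>2 (t - of_int k)) (bspline 3) UNIV"
    using assms unfolding spline_pairs_def by blast
  then have sum: "L2_has_sum (\<lambda>k t. \<Sum>i<2. (case i of 0 \<Rightarrow> c | Suc _ \<Rightarrow> d) k *
      (case i of 0 \<Rightarrow> \<phi>\<^sub>1 | Suc _ \<Rightarrow> \<phi>\<^sub>2) (t - of_int k)) (bspline 3) UNIV"
    by (simp add: lessThan_2)
  define lo hi where "lo = (\<lambda>i::nat. if i = 0 then a else a')" and "hi = (\<lambda>i::nat. if i = 0 then b else b')"
  show False
  proof (rule small_support_imp_local_dependency[OF sum, of lo hi 4])
    fix n :: int and u v :: real and l :: "nat \<Rightarrow> real"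
    assume *: "of_int n \<le> u" "u < v" "v \<le> of_int n + 1"
      "AE t in lborel. u < t \<and> t < v \<longrightarrow> (\<Sum>j<4. l j * bspline 3 (t - of_int n + real j)) = 0"
    assume "\<exists>j<4. l j \<noteq> 0"
    then show False using bspline3_shifts_independent[OF *] by blast
  next
    fix i :: nat assume "i < 2"
    then have "i = 0 \<or> i = Suc 0" by linarith
    then show "lo i \<le> hi i" "AE t in lborel. t \<notin> {lo i..hi i} \<longrightarrow> (case i of 0 \<Rightarrow> \<phi>\<^sub>1 | Suc _ \<Rightarrow> \<phi>\<^sub>2) t = 0"
      using ab supp by (auto simp: lo_def hi_def)
  qed (use ab in \<open>simp add: lo_def hi_def lessThan_2\<close>)
qed

theorem corollary3:
  shows "(hermite1, hermite2) \<in> spline_pairs \<and>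
    (\<forall>(\<phi>\<^sub>1, \<phi>\<^sub>2) \<in> spline_pairs.
       supp_size hermite1 + supp_size hermite2 \<le> supp_size \<phi>\<^sub>1 + supp_size \<phi>\<^sub>2)"
proof -
  have "supp_size hermite1 \<le> ennreal (1 - (- 1))" "supp_size hermite2 \<le> ennreal (1 - (- 1))"
    by (rule supp_size_le; auto intro!: hermite_eq_0)+
  then have "supp_size hermite1 + supp_size hermite2 \<le> ennreal (1 - (- 1)) + ennreal (1 - (- 1))"
    by (rule add_mono)
  also have "\<dots> = ennreal 4"
    by (subst ennreal_plus [symmetric]) simp_all
  finally have "supp_size hermite1 + supp_size hermite2 \<le> 4" by simp
  then show ?thesis
    using hermite_in_spline_pairs spline_pairs_support_ge by (auto intro: order_trans)
qed

end
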